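(* Let $(M,m,V,\varkappa)$ be a mechanical system with gyroscopic forces, and let $h\in\mathbf{R}$ be such that $M_h=\{x\in M: V(x)<h\}$ is non-empty. Endow $M_h$ with the Riemannian metric $m_h=2(h-V)m$, and let $\Pi_h$ be the operator taking 1-forms on $M_h$ to vector fields on $M_h$ (and, pointwise, covectors to vectors) defined by $m_h(\Pi_h(\lambda),Y)=\lambda(Y)$ for all $Y$. (1) Let $x(t)$ be a motion in the system $(M,m,V,\varkappa)$, lying in $M_h$, whose total energy equals $h$, i.e. $\frac12\langle x'(t),x'(t)\rangle+V(x(t))=h$. Let $\overline{x}(\tau)$ denote the same curve (traversed in the same direction) parameterized by the arclength $\tau$ of the metric $m_h$. Then $$\frac{D}{d\tau}\frac{d\overline{x}}{d\tau}=-\Pi_h\left(\mathrm{i}_{\frac{d\overline{x}}{d\tau}}\varkappa\right),\qquad ( * )$$ where the covariant derivative $D/d\tau$ is that of the Levi-Civita connection of $m_h$. (2) Conversely, let $\overline{x}(\tau)$ be a curve in $M_h$ parameterized by the arclength $\tau$ of the metric $m_h$ and satisfying $( * )$. Then there exists a change of the parameter $\tau=\tau(t)$ such that the curve $x(t)=\overline{x}(\tau(t))$ is a motion in the system $(M,m,V,\varkappa)$ and satisfies $\frac12\langle x'(t),x'(t)\rangle+V(x(t))=h$.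
   Context: A mechanical system with gyroscopic forces is a 4-tuple $(M,m,V,\varkappa)$, where $M$ is a smooth manifold, $m=\langle\cdot,\cdot\rangle$ a smooth Riemannian metric on $M$, $V$ a smooth function on $M$ and $\varkappa$ a smooth closed 2-form on $M$. Let $p_M:T(M)\to M$ be the tangent bundle projection and $K(w)=\frac12\langle w,w\rangle$ for $w\in T(M)$. The Lagrange forms generated by $m$ are the 1-form $\theta$ on $T(M)$ with $\theta_w(Y)=\langle w,Tp_M(Y)\rangle$ for $Y\in T_w(T(M))$, and the 2-form $\sigma=\mathrm{d}\theta$. The dynamical system corresponding to $(M,m,V,\varkappa)$ is the unique vector field $X$ on $T(M)$ such that $\mathrm{i}_X(\sigma+p_M^*\varkappa)=-\mathrm{d}(K+V\circ p_M)$; it satisfies $Tp_M\circ X=\mathrm{id}_{T(M)}$. A motion in the system is a curve $x(t)=p_M(w(t))$, where $w(t)$ is an integral curve of $X$ (then $w(t)=x'(t)$). Here $\mathrm{i}_Y\omega$ denotes the inner product (contraction in the first argument) of a vector $Y$ with a form $\omega$. *)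

theory Defs
  imports "HOL-Analysis.Analysis"
begin

section \<open>Smooth manifolds\<close>

primrec Ck_on :: "nat \<Rightarrow> 'a::real_normed_vector set \<Rightarrow> ('a \<Rightarrow> 'b::real_normed_vector) \<Rightarrow> bool"
  where
    "Ck_on 0 S f \<longleftrightarrow> continuous_on S f"
  | "Ck_on (Suc k) S f \<longleftrightarrow> (\<forall>x\<in>S. f differentiable (at x)) \<and>
       (\<forall>v. Ck_on k S (\<lambda>x. frechet_derivative f (at x) v))"

text \<open>Of class \<open>C\<^sup>\<infinity>\<close>; used for open \<open>S\<close> only.\<close>

definition smooth_on :: "'a::real_normed_vector set \<Rightarrow> ('a \<Rightarrow> 'b::real_normed_vector) \<Rightarrow> bool"
  where "smooth_on S f \<longleftrightarrow> (\<forall>k. Ck_on k S f)"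

text \<open>
  A manifold is given by an atlas, a family of charts indexed by a set. The underlying set is the
  union of the chart domains, and its topology is the one induced by the charts. The values of
  \<open>chart M i\<close> outside \<open>chart_dom M i\<close> are irrelevant. The atlas need not be maximal.
\<close>

record ('i, 'a, 'e) manifold =
  chart_index :: "'i set"
  chart_dom :: "'i \<Rightarrow> 'a set"
  chart :: "'i \<Rightarrow> 'a \<Rightarrow> 'e"

definition points :: "('i, 'a, 'e) manifold \<Rightarrow> 'a set"
  where "points M = (\<Union>i\<in>chart_index M. chart_dom M i)"

definition charts_at :: "('i, 'a, 'e) manifold \<Rightarrow> 'a \<Rightarrow> 'i set"
  where "charts_at M p = {i \<in> chart_index M. p \<in> chart_dom M i}"

definition chart_inv :: "('i, 'a, 'e) manifold \<Rightarrow> 'i \<Rightarrow> 'e \<Rightarrow> 'a"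
  where "chart_inv M i = inv_into (chart_dom M i) (chart M i)"

definition manifold_topology :: "('i, 'a, 'e::euclidean_space) manifold \<Rightarrow> 'a topology"
  where "manifold_topology M = topology_generated_by
    {W. W \<subseteq> points M \<and> (\<forall>i\<in>chart_index M. open (chart M i ` (W \<inter> chart_dom M i)))}"

definition smooth_manifold :: "('i, 'a, 'e::euclidean_space) manifold \<Rightarrow> bool"
  where "smooth_manifold M \<longleftrightarrow>
    (\<forall>i\<in>chart_index M. inj_on (chart M i) (chart_dom M i)) \<and>
    (\<forall>i\<in>chart_index M. open (chart M i ` chart_dom M i)) \<and>
    (\<forall>i\<in>chart_index M. \<forall>j\<in>chart_index M.
       open (chart M i ` (chart_dom M i \<inter> chart_dom M j)) \<and>
       smooth_on (chart M i ` (chart_dom M i \<inter> chart_dom M j)) (chart M j \<circ> chart_inv M i)) \<and>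
    Hausdorff_space (manifold_topology M) \<and>
    second_countable (manifold_topology M)"

definition open_submanifold ::
    "('i, 'a, 'e) manifold \<Rightarrow> 'a set \<Rightarrow> ('i, 'a, 'e) manifold"
  where "open_submanifold M W = M\<lparr>chart_dom := \<lambda>i. chart_dom M i \<inter> W\<rparr>"

definition smooth_function :: "('i, 'a, 'e::euclidean_space) manifold \<Rightarrow> ('a \<Rightarrow> real) \<Rightarrow> bool"
  where "smooth_function M f \<longleftrightarrow>
    (\<forall>i\<in>chart_index M. smooth_on (chart M i ` chart_dom M i) (f \<circ> chart_inv M i))"


section \<open>Tangent vectors and the tangent bundle\<close>

text \<open>
  A tangent vector at \<open>p\<close> is the family of its coordinate representations in the charts around \<open>p\<close>,
  related by the derivatives of the chart changes (and 0 at the other indices). An open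
  submanifold therefore has the same tangent spaces as the ambient manifold.
\<close>

type_synonym ('i, 'e) tvec = "'i \<Rightarrow> 'e"

definition tangent_space ::
    "('i, 'a, 'e::euclidean_space) manifold \<Rightarrow> 'a \<Rightarrow> ('i, 'e) tvec set"
  where "tangent_space M p = {v.
    (\<forall>i\<in>charts_at M p. \<forall>j\<in>charts_at M p.
       v j = frechet_derivative (chart M j \<circ> chart_inv M i) (at (chart M i p)) (v i)) \<and>
    (\<forall>j. j \<notin> charts_at M p \<longrightarrow> v j = 0)}"

definition tangent_bundle ::
    "('i, 'a, 'e::euclidean_space) manifold \<Rightarrow> ('i, 'a \<times> ('i, 'e) tvec, 'e \<times> 'e) manifold"
  where "tangent_bundle M =
    \<lparr>chart_index = chart_index M,
     chart_dom = (\<lambda>i. {(p, v). p \<in> chart_dom M i \<and> v \<in> tangent_space M p}),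
     chart = (\<lambda>i (p, v). (chart M i p, v i))\<rparr>"

text \<open>
  Pointwise notions below are computed in one chart around the point; on a smooth manifold the
  result does not depend on the choice.
\<close>

definition chart_at :: "('i, 'a, 'e) manifold \<Rightarrow> 'a \<Rightarrow> 'i"
  where "chart_at M p = (SOME i. i \<in> charts_at M p)"

text \<open>The tangent vector at \<open>p\<close> whose representation in the chart \<open>i\<close> is \<open>a\<close>.\<close>

definition coord_vector ::
    "('i, 'a, 'e::euclidean_space) manifold \<Rightarrow> 'i \<Rightarrow> 'a \<Rightarrow> 'e \<Rightarrow> ('i, 'e) tvec"
  where "coord_vector M i p a = (\<lambda>j. if j \<in> charts_at M p
    then frechet_derivative (chart M j \<circ> chart_inv M i) (at (chart M i p)) a else 0)"

text \<open>The tangent map of \<open>f\<close> from \<open>M\<close> to \<open>N\<close> at the point \<open>p\<close>.\<close>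

definition tangent_map ::
    "('i, 'a, 'e::euclidean_space) manifold \<Rightarrow> ('j, 'b, 'f::euclidean_space) manifold \<Rightarrow>
     ('a \<Rightarrow> 'b) \<Rightarrow> 'a \<Rightarrow> ('i, 'e) tvec \<Rightarrow> ('j, 'f) tvec"
  where "tangent_map M N f p v = (let i = chart_at M p in
    (\<lambda>j. if j \<in> charts_at N (f p)
      then frechet_derivative (chart N j \<circ> f \<circ> chart_inv M i) (at (chart M i p)) (v i) else 0))"


section \<open>Covariant tensors and differential forms\<close>

type_synonym ('i, 'a, 'e) tensor1 = "'a \<Rightarrow> ('i, 'e) tvec \<Rightarrow> real"
type_synonym ('i, 'a, 'e) tensor2 = "'a \<Rightarrow> ('i, 'e) tvec \<Rightarrow> ('i, 'e) tvec \<Rightarrow> real"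

definition local_rep1 ::
    "('i, 'a, 'e::euclidean_space) manifold \<Rightarrow> ('i, 'a, 'e) tensor1 \<Rightarrow> 'i \<Rightarrow> 'e \<Rightarrow> 'e \<Rightarrow> real"
  where "local_rep1 M \<omega> i x a = (let p = chart_inv M i x in \<omega> p (coord_vector M i p a))"

definition local_rep2 ::
    "('i, 'a, 'e::euclidean_space) manifold \<Rightarrow> ('i, 'a, 'e) tensor2 \<Rightarrow> 'i \<Rightarrow> 'e \<Rightarrow> 'e \<Rightarrow> 'e \<Rightarrow> real"
  where "local_rep2 M \<omega> i x a b =
    (let p = chart_inv M i x in \<omega> p (coord_vector M i p a) (coord_vector M i p b))"

definition smooth_tensor2 ::
    "('i, 'a, 'e::euclidean_space) manifold \<Rightarrow> ('i, 'a, 'e) tensor2 \<Rightarrow> bool"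
  where "smooth_tensor2 M \<omega> \<longleftrightarrow>
    (\<forall>p\<in>points M. \<forall>u\<in>tangent_space M p. \<forall>v\<in>tangent_space M p. \<forall>w\<in>tangent_space M p. \<forall>c.
       \<omega> p (\<lambda>i. c *\<^sub>R u i + v i) w = c * \<omega> p u w + \<omega> p v w \<and>
       \<omega> p w (\<lambda>i. c *\<^sub>R u i + v i) = c * \<omega> p w u + \<omega> p w v) \<and>
    (\<forall>i\<in>chart_index M. \<forall>a b.
       smooth_on (chart M i ` chart_dom M i) (\<lambda>x. local_rep2 M \<omega> i x a b))"

definition riemannian_metric ::
    "('i, 'a, 'e::euclidean_space) manifold \<Rightarrow> ('i, 'a, 'e) tensor2 \<Rightarrow> bool"
  where "riemannian_metric M g \<longleftrightarrow> smooth_tensor2 M g \<and>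
    (\<forall>p\<in>points M. \<forall>u\<in>tangent_space M p. \<forall>v\<in>tangent_space M p. g p u v = g p v u) \<and>
    (\<forall>p\<in>points M. \<forall>u\<in>tangent_space M p. u \<noteq> (\<lambda>_. 0) \<longrightarrow> g p u u > 0)"

definition smooth_2form ::
    "('i, 'a, 'e::euclidean_space) manifold \<Rightarrow> ('i, 'a, 'e) tensor2 \<Rightarrow> bool"
  where "smooth_2form M \<omega> \<longleftrightarrow> smooth_tensor2 M \<omega> \<and>
    (\<forall>p\<in>points M. \<forall>u\<in>tangent_space M p. \<omega> p u u = 0)"

text \<open>Exterior derivatives of functions, 1-forms and 2-forms, without combinatorial factors.\<close>

definition ext_deriv0 ::
    "('i, 'a, 'e::euclidean_space) manifold \<Rightarrow> ('a \<Rightarrow> real) \<Rightarrow> ('i, 'a, 'e) tensor1"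
  where "ext_deriv0 M f p u = (let i = chart_at M p in
    frechet_derivative (f \<circ> chart_inv M i) (at (chart M i p)) (u i))"

definition ext_deriv1 ::
    "('i, 'a, 'e::euclidean_space) manifold \<Rightarrow> ('i, 'a, 'e) tensor1 \<Rightarrow> ('i, 'a, 'e) tensor2"
  where "ext_deriv1 M \<omega> p u v = (let i = chart_at M p; x = chart M i p in
    frechet_derivative (\<lambda>y. local_rep1 M \<omega> i y (v i)) (at x) (u i) -
    frechet_derivative (\<lambda>y. local_rep1 M \<omega> i y (u i)) (at x) (v i))"

definition ext_deriv2 ::
    "('i, 'a, 'e::euclidean_space) manifold \<Rightarrow> ('i, 'a, 'e) tensor2 \<Rightarrow>
     'a \<Rightarrow> ('i, 'e) tvec \<Rightarrow> ('i, 'e) tvec \<Rightarrow> ('i, 'e) tvec \<Rightarrow> real"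
  where "ext_deriv2 M \<omega> p u v w = (let i = chart_at M p; x = chart M i p in
    frechet_derivative (\<lambda>y. local_rep2 M \<omega> i y (v i) (w i)) (at x) (u i) -
    frechet_derivative (\<lambda>y. local_rep2 M \<omega> i y (u i) (w i)) (at x) (v i) +
    frechet_derivative (\<lambda>y. local_rep2 M \<omega> i y (u i) (v i)) (at x) (w i))"

definition closed_2form ::
    "('i, 'a, 'e::euclidean_space) manifold \<Rightarrow> ('i, 'a, 'e) tensor2 \<Rightarrow> bool"
  where "closed_2form M \<omega> \<longleftrightarrow> smooth_2form M \<omega> \<and>
    (\<forall>p\<in>points M. \<forall>u\<in>tangent_space M p. \<forall>v\<in>tangent_space M p. \<forall>w\<in>tangent_space M p.
       ext_deriv2 M \<omega> p u v w = 0)"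

text \<open>The pullback \<open>f\<^sup>*\<omega>\<close> to \<open>M\<close> of a tensor \<open>\<omega>\<close> on \<open>N\<close>.\<close>

definition pullback2 ::
    "('i, 'a, 'e::euclidean_space) manifold \<Rightarrow> ('j, 'b, 'f::euclidean_space) manifold \<Rightarrow>
     ('a \<Rightarrow> 'b) \<Rightarrow> ('j, 'b, 'f) tensor2 \<Rightarrow> ('i, 'a, 'e) tensor2"
  where "pullback2 M N f \<omega> p u v = \<omega> (f p) (tangent_map M N f p u) (tangent_map M N f p v)"


section \<open>Curves\<close>

definition open_interval :: "real set \<Rightarrow> bool"
  where "open_interval I \<longleftrightarrow> open I \<and> is_interval I \<and> I \<noteq> {}"

text \<open>The curve \<open>c\<close> is differentiable at \<open>t\<close> with velocity \<open>\<xi>\<close>.\<close>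

definition has_velocity ::
    "('i, 'a, 'e::euclidean_space) manifold \<Rightarrow> (real \<Rightarrow> 'a) \<Rightarrow> real \<Rightarrow> ('i, 'e) tvec \<Rightarrow> bool"
  where "has_velocity M c t \<xi> \<longleftrightarrow> c t \<in> points M \<and> \<xi> \<in> tangent_space M (c t) \<and>
    (\<forall>i\<in>charts_at M (c t).
       (\<forall>\<^sub>F s in nhds t. c s \<in> chart_dom M i) \<and>
       ((\<lambda>s. chart M i (c s)) has_vector_derivative \<xi> i) (at t))"

definition velocity ::
    "('i, 'a, 'e::euclidean_space) manifold \<Rightarrow> (real \<Rightarrow> 'a) \<Rightarrow> real \<Rightarrow> ('i, 'e) tvec"
  where "velocity M c t = (THE \<xi>. has_velocity M c t \<xi>)"

definition differentiable_curve ::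
    "('i, 'a, 'e::euclidean_space) manifold \<Rightarrow> real set \<Rightarrow> (real \<Rightarrow> 'a) \<Rightarrow> bool"
  where "differentiable_curve M I c \<longleftrightarrow>
    open_interval I \<and> (\<forall>t\<in>I. has_velocity M c t (velocity M c t))"

definition integral_curve ::
    "('i, 'a, 'e::euclidean_space) manifold \<Rightarrow> ('a \<Rightarrow> ('i, 'e) tvec) \<Rightarrow>
     real set \<Rightarrow> (real \<Rightarrow> 'a) \<Rightarrow> bool"
  where "integral_curve M X I c \<longleftrightarrow> open_interval I \<and> (\<forall>t\<in>I. has_velocity M c t (X (c t)))"


section \<open>Riemannian geometry\<close>

text \<open>The operator taking covectors to vectors, \<open>g p (sharp M g p \<alpha>) v = \<alpha> v\<close>.\<close>

definition sharp ::
    "('i, 'a, 'e::euclidean_space) manifold \<Rightarrow> ('i, 'a, 'e) tensor2 \<Rightarrow>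
     'a \<Rightarrow> (('i, 'e) tvec \<Rightarrow> real) \<Rightarrow> ('i, 'e) tvec"
  where "sharp M g p \<alpha> = (THE u. u \<in> tangent_space M p \<and>
    (\<forall>v\<in>tangent_space M p. g p u v = \<alpha> v))"

text \<open>
  The Levi-Civita connection \<open>\<nabla>\<close> of \<open>g\<close>, given in the chart \<open>i\<close> by its Christoffel map
  \<open>\<Gamma> a b = \<nabla>\<^bsub>a\<^esub> b\<close> at the coordinate point \<open>x\<close>, where \<open>a\<close> and \<open>b\<close> stand for coordinate vector
  fields with constant coefficients (so \<open>[a, b] = 0\<close>). The conjuncts say that \<open>\<nabla>\<close> is
  torsion-free, and metric: \<open>a (g b c) = g (\<nabla>\<^bsub>a\<^esub> b) c + g b (\<nabla>\<^bsub>a\<^esub> c)\<close>.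
\<close>

definition levi_civita ::
    "('i, 'a, 'e::euclidean_space) manifold \<Rightarrow> ('i, 'a, 'e) tensor2 \<Rightarrow> 'i \<Rightarrow> 'e \<Rightarrow> 'e \<Rightarrow> 'e \<Rightarrow> 'e"
  where "levi_civita M g i x = (THE \<Gamma>. bilinear \<Gamma> \<and>
    (\<forall>a b. \<Gamma> a b = \<Gamma> b a) \<and>
    (\<forall>a b c. frechet_derivative (\<lambda>y. local_rep2 M g i y b c) (at x) a =
       local_rep2 M g i x (\<Gamma> a b) c + local_rep2 M g i x b (\<Gamma> a c)))"

text \<open>
  The vector field \<open>Y\<close> along the curve \<open>c\<close> has at \<open>t\<close> the covariant derivative \<open>Z\<close> with respect to
  the Levi-Civita connection of \<open>g\<close>.
\<close>

definition has_covariant_derivative ::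
    "('i, 'a, 'e::euclidean_space) manifold \<Rightarrow> ('i, 'a, 'e) tensor2 \<Rightarrow> (real \<Rightarrow> 'a) \<Rightarrow>
     (real \<Rightarrow> ('i, 'e) tvec) \<Rightarrow> real \<Rightarrow> ('i, 'e) tvec \<Rightarrow> bool"
  where "has_covariant_derivative M g c Y t Z \<longleftrightarrow>
    has_velocity M c t (velocity M c t) \<and> Z \<in> tangent_space M (c t) \<and>
    (\<forall>i\<in>charts_at M (c t). \<exists>Y'. ((\<lambda>s. Y s i) has_vector_derivative Y') (at t) \<and>
       Z i = Y' + levi_civita M g i (chart M i (c t)) (velocity M c t i) (Y t i))"

definition curve_length ::
    "('i, 'a, 'e::euclidean_space) manifold \<Rightarrow> ('i, 'a, 'e) tensor2 \<Rightarrow> real \<Rightarrow> real \<Rightarrow>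
     (real \<Rightarrow> 'a) \<Rightarrow> real"
  where "curve_length M g a b c =
    integral {a..b} (\<lambda>t. sqrt (g (c t) (velocity M c t) (velocity M c t)))"

definition parametrized_by_arclength ::
    "('i, 'a, 'e::euclidean_space) manifold \<Rightarrow> ('i, 'a, 'e) tensor2 \<Rightarrow> real set \<Rightarrow>
     (real \<Rightarrow> 'a) \<Rightarrow> bool"
  where "parametrized_by_arclength M g J c \<longleftrightarrow> differentiable_curve M J c \<and>
    (\<forall>a\<in>J. \<forall>b\<in>J. a \<le> b \<longrightarrow> curve_length M g a b c = b - a)"

text \<open>
  \<open>c'\<close> on \<open>J\<close> is the curve \<open>c\<close> on \<open>I\<close> reparametrized, in the same direction, by its arclength \<open>s\<close>
  (which is determined up to an additive constant).
\<close>

definition arclength_reparametrization ::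
    "('i, 'a, 'e::euclidean_space) manifold \<Rightarrow> ('i, 'a, 'e) tensor2 \<Rightarrow> real set \<Rightarrow>
     (real \<Rightarrow> 'a) \<Rightarrow> real set \<Rightarrow> (real \<Rightarrow> 'a) \<Rightarrow> bool"
  where "arclength_reparametrization M g I c J c' \<longleftrightarrow> (\<exists>s::real \<Rightarrow> real. s ` I = J \<and>
    (\<forall>a\<in>I. \<forall>b\<in>I. a \<le> b \<longrightarrow> s b - s a = curve_length M g a b c) \<and>
    (\<forall>t\<in>I. c' (s t) = c t))"

text \<open>\<open>t \<mapsto> s t\<close> is a change of parameter from \<open>I\<close> to \<open>J\<close> preserving the direction.\<close>

definition parameter_change :: "real set \<Rightarrow> real set \<Rightarrow> (real \<Rightarrow> real) \<Rightarrow> bool"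
  where "parameter_change I J s \<longleftrightarrow> bij_betw s I J \<and>
    (\<exists>s'. continuous_on I s' \<and> (\<forall>t\<in>I. (s has_real_derivative s' t) (at t) \<and> s' t > 0))"


section \<open>Mechanical systems with gyroscopic forces\<close>

definition mechanical_system ::
    "('i, 'a, 'e::euclidean_space) manifold \<Rightarrow> ('i, 'a, 'e) tensor2 \<Rightarrow> ('a \<Rightarrow> real) \<Rightarrow>
     ('i, 'a, 'e) tensor2 \<Rightarrow> bool"
  where "mechanical_system M m V \<kappa> \<longleftrightarrow> smooth_manifold M \<and> riemannian_metric M m \<and>
    smooth_function M V \<and> closed_2form M \<kappa>"

definition kinetic_energy ::
    "('i, 'a, 'e::euclidean_space) tensor2 \<Rightarrow> 'a \<times> ('i, 'e) tvec \<Rightarrow> real"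
  where "kinetic_energy m w = m (fst w) (snd w) (snd w) / 2"

definition lagrange_1form ::
    "('i, 'a, 'e::euclidean_space) manifold \<Rightarrow> ('i, 'a, 'e) tensor2 \<Rightarrow>
     ('i, 'a \<times> ('i, 'e) tvec, 'e \<times> 'e) tensor1"
  where "lagrange_1form M m w Y = m (fst w) (snd w) (tangent_map (tangent_bundle M) M fst w Y)"

definition lagrange_2form ::
    "('i, 'a, 'e::euclidean_space) manifold \<Rightarrow> ('i, 'a, 'e) tensor2 \<Rightarrow>
     ('i, 'a \<times> ('i, 'e) tvec, 'e \<times> 'e) tensor2"
  where "lagrange_2form M m = ext_deriv1 (tangent_bundle M) (lagrange_1form M m)"

text \<open>
  The vector field \<open>X\<close> on the tangent bundle with \<open>i\<^sub>X (\<sigma> + p\<^sup>*\<kappa>) = - d (K + V \<circ> p)\<close>. Since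
  \<open>\<sigma> + p\<^sup>*\<kappa>\<close> is nondegenerate, this equation determines the value of \<open>X\<close> at every point.
\<close>

definition dynamical_system ::
    "('i, 'a, 'e::euclidean_space) manifold \<Rightarrow> ('i, 'a, 'e) tensor2 \<Rightarrow> ('a \<Rightarrow> real) \<Rightarrow>
     ('i, 'a, 'e) tensor2 \<Rightarrow> 'a \<times> ('i, 'e) tvec \<Rightarrow> ('i, 'e \<times> 'e) tvec"
  where "dynamical_system M m V \<kappa> w = (THE X. X \<in> tangent_space (tangent_bundle M) w \<and>
    (\<forall>Y\<in>tangent_space (tangent_bundle M) w.
       lagrange_2form M m w X Y + pullback2 (tangent_bundle M) M fst \<kappa> w X Y =
       - ext_deriv0 (tangent_bundle M) (\<lambda>w. kinetic_energy m w + V (fst w)) w Y))"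

definition motion ::
    "('i, 'a, 'e::euclidean_space) manifold \<Rightarrow> ('i, 'a, 'e) tensor2 \<Rightarrow> ('a \<Rightarrow> real) \<Rightarrow>
     ('i, 'a, 'e) tensor2 \<Rightarrow> real set \<Rightarrow> (real \<Rightarrow> 'a) \<Rightarrow> bool"
  where "motion M m V \<kappa> I x \<longleftrightarrow>
    (\<exists>w. integral_curve (tangent_bundle M) (dynamical_system M m V \<kappa>) I w \<and>
         (\<forall>t\<in>I. x t = fst (w t)))"

definition total_energy ::
    "('i, 'a, 'e::euclidean_space) manifold \<Rightarrow> ('i, 'a, 'e) tensor2 \<Rightarrow> ('a \<Rightarrow> real) \<Rightarrow>
     (real \<Rightarrow> 'a) \<Rightarrow> real \<Rightarrow> real"
  where "total_energy M m V x t = m (x t) (velocity M x t) (velocity M x t) / 2 + V (x t)"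

definition sublevel_manifold ::
    "('i, 'a, 'e) manifold \<Rightarrow> ('a \<Rightarrow> real) \<Rightarrow> real \<Rightarrow> ('i, 'a, 'e) manifold"
  where "sublevel_manifold M V h = open_submanifold M {x \<in> points M. V x < h}"

definition jacobi_metric ::
    "('i, 'a, 'e) tensor2 \<Rightarrow> ('a \<Rightarrow> real) \<Rightarrow> real \<Rightarrow> ('i, 'a, 'e) tensor2"
  where "jacobi_metric m V h p u v = 2 * (h - V p) * m p u v"

text \<open>The equation \<open>D/d\<tau> c' = - \<Pi> (i\<^bsub>c'\<^esub> \<kappa>)\<close> at every \<open>\<tau> \<in> J\<close>, for the metric \<open>g\<close>.\<close>

definition gyroscopic_geodesic ::
    "('i, 'a, 'e::euclidean_space) manifold \<Rightarrow> ('i, 'a, 'e) tensor2 \<Rightarrow> ('i, 'a, 'e) tensor2 \<Rightarrow>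
     real set \<Rightarrow> (real \<Rightarrow> 'a) \<Rightarrow> bool"
  where "gyroscopic_geodesic M g \<kappa> J c \<longleftrightarrow> (\<forall>\<tau>\<in>J.
    has_covariant_derivative M g c (velocity M c) \<tau>
      (- sharp M g (c \<tau>) (\<kappa> (c \<tau>) (velocity M c \<tau>))))"

end

theory Submission
  imports Defs
begin

text \<open>
  Write \<open>f = 2 (h - V)\<close> for the conformal factor, so that the metric \<open>m\<^sub>h\<close> is \<open>f m\<close>, and let \<open>\<nabla>\<close> be
  the Levi-Civita connection of \<open>m\<close>. In a chart the tangent vectors of the tangent bundle are pairs
  \<open>(\<xi>, a)\<close>, and the equation defining the dynamical system falls into two parts. Testing it against
  vertical vectors gives \<open>\<xi> = v\<close>, so integral curves are velocity lifts; testing it against the others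
  gives Newton's equation \<open>\<nabla>\<^bsub>v\<^esub> v = - grad V - (i\<^bsub>v\<^esub> \<kappa>)\<^sup>#\<close> (lemma \<open>dynamical_system_iff\<close>).

  On the energy level \<open>h\<close> one has \<open>\<langle>v, v\<rangle> = f\<close>. Hence the speed of a motion in the metric \<open>m\<^sub>h\<close> is \<open>f\<close>,
  the arclength satisfies \<open>d\<tau> = f dt\<close>, and the unit velocity is \<open>u = v / f\<close>. The Koszul formula for
  \<open>f m\<close> gives for the connection \<open>\<nabla>\<^sup>h\<close> of \<open>m\<^sub>h\<close>
  \<open>\<nabla>\<^sup>h\<^bsub>u\<^esub> u = \<nabla>\<^bsub>u\<^esub> u + (df(u) / f) u - \<langle>u, u\<rangle> grad f / (2 f)\<close>.
  The term along \<open>u\<close> is compensated by the change of parameter. Since \<open>\<langle>u, u\<rangle> = 1 / f\<close> and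
  \<open>grad f = - 2 grad V\<close>, the last term is \<open>f\<^sup>-\<^sup>2 grad V\<close>, which cancels the potential force exactly, and
  only the gyroscopic force remains. So the two equations of motion are equivalent at each point
  (lemma \<open>gyroscopic_geodesic_iff_newton\<close>), and both assertions follow by inverting the
  change of parameter: in the first one the arclength, in the second one a primitive of \<open>1 / f\<close>
  along the curve. In the second one the energy is \<open>h\<close> because a curve parametrized by arclength has
  unit speed for \<open>m\<^sub>h\<close>.

  The dynamical system is evaluated in one chosen chart around each point, whereas the covariant
  derivative is required in all charts. For the first assertion Newton's equation is therefore
  transported between charts (lemma \<open>newton_change\<close>); its invariance uses the symmetry of the
  second derivatives of the chart changes. For the second assertion the equation in the chosen chart
  is enough, because a curve that is differentiable in one chart has a velocity
  (lemma \<open>has_velocity_from_chart\<close>).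
\<close>


section \<open>Differential calculus in coordinates\<close>

lemma frechet_derivative_eqI:
  "(f has_derivative D) (at x) \<Longrightarrow> frechet_derivative f (at x) = D"
  by (metis frechet_derivative_at)

lemma has_derivative_cong_ev:
  assumes "(f has_derivative D) (at x)" "\<forall>\<^sub>F y in nhds x. f y = g y"
  shows "(g has_derivative D) (at x)"
proof -
    have 1: "\<forall>\<^sub>F y in at x. f y = g y" "f x = g x"
      using assms(2) eventually_nhds_x_imp_x[OF assms(2)] by (auto simp: eventually_at_filter elim: eventually_mono)
    show ?thesis
      by (rule has_derivative_transform_eventually[OF assms(1) 1]) auto
qed

lemma frechet_derivative_cong_ev:
  assumes "\<forall>\<^sub>F y in nhds x. f y = g y"
  shows "frechet_derivative f (at x) = frechet_derivative g (at x)"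
proof -
  have "\<forall>\<^sub>F y in nhds x. g y = f y" using assms by eventually_elim simp
  then have "(f has_derivative D) (at x) \<longleftrightarrow> (g has_derivative D) (at x)" for D
    using has_derivative_cong_ev assms by blast
  then show ?thesis by (simp add: frechet_derivative_def)
qed

text \<open>
  By the mean value theorem in the direction \<open>u\<close>, the second difference is \<open>t\<close> times the increment
  of \<open>y \<mapsto> Df(y) u\<close> over a segment of direction \<open>t v\<close>, which is \<open>t A' v\<close> up to \<open>o(t)\<close>. As the
  second difference is symmetric in \<open>u\<close> and \<open>v\<close>, so is its limit.
\<close>

lemma second_difference_limit:
  fixes f :: "'e::real_normed_vector \<Rightarrow> real"
  assumes S: "open S" "x \<in> S"
    and f: "\<And>y. y \<in> S \<Longrightarrow> f differentiable (at y)"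
    and A: "((\<lambda>y. frechet_derivative f (at y) u) has_derivative A') (at x)"
  shows "((\<lambda>t. (f (x + t *\<^sub>R u + t *\<^sub>R v) - f (x + t *\<^sub>R u) - f (x + t *\<^sub>R v) + f x) / t\<^sup>2)
     \<longlongrightarrow> A' v) (at_right 0)"
proof (rule tendstoI)
  fix e :: real assume "e > 0"
  \<comment> \<open>\<open>t L\<close> bounds the sum of the distances from \<open>x\<close> of the two points that are compared below\<close>
  define L where "L = 2 * norm u + norm v + 1"
  have L: "L > 0" by (simp add: L_def add_nonneg_pos)
  define A where "A = (\<lambda>y. frechet_derivative f (at y) u)"
  have bl: "bounded_linear A'" using assms has_derivative_bounded_linear by blast
  interpret A': bounded_linear A' by fact
  have "e / (2 * L) > 0" using \<open>e > 0\<close> L by simp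
  then obtain d where d: "d > 0"
    "\<And>y. norm (y - x) < d \<Longrightarrow> norm (A y - A x - A' (y - x)) \<le> e / (2 * L) * norm (y - x)"
    using assms(4) unfolding has_derivative_at_alt A_def by metis
  obtain r where r: "r > 0" "ball x r \<subseteq> S" using S openE by blast
  define k where "k = min d r / L"
  have "k > 0" using d(1) r(1) L by (simp add: k_def)
  have "dist ((f (x + t *\<^sub>R u + t *\<^sub>R v) - f (x + t *\<^sub>R u) - f (x + t *\<^sub>R v) + f x) / t\<^sup>2) (A' v) < e"
    if t: "0 < t" "t < k" for t
  proof -
    have tL: "t * L < min d r" using t L by (simp add: k_def field_simps)
    have small: "norm (\<rho> *\<^sub>R u) \<le> t * norm u" "norm (\<rho> *\<^sub>R u + t *\<^sub>R v) \<le> t * (norm u + norm v)"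
      if "0 \<le> \<rho>" "\<rho> \<le> t" for \<rho>
    proof -
      show 1: "norm (\<rho> *\<^sub>R u) \<le> t * norm u" using that by (simp add: mult_right_mono)
      have "norm (\<rho> *\<^sub>R u + t *\<^sub>R v) \<le> norm (\<rho> *\<^sub>R u) + norm (t *\<^sub>R v)" by (rule norm_triangle_ineq)
      then show "norm (\<rho> *\<^sub>R u + t *\<^sub>R v) \<le> t * (norm u + norm v)"
        using 1 t by (simp add: algebra_simps)
    qed
    have le: "t * norm u \<le> t * L" "t * (norm u + norm v) \<le> t * L"
      using t by (auto simp: L_def)
    have inball: "norm (\<rho> *\<^sub>R u) < min d r" "norm (\<rho> *\<^sub>R u + t *\<^sub>R v) < min d r"
      if "0 \<le> \<rho>" "\<rho> \<le> t" for \<rho>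
      using small[OF that] le tL by linarith+
    have inS: "x + \<rho> *\<^sub>R u \<in> S" "x + \<rho> *\<^sub>R u + t *\<^sub>R v \<in> S" if "0 \<le> \<rho>" "\<rho> \<le> t" for \<rho>
      using inball[OF that] r(2) by (auto simp: dist_norm subset_iff add.assoc norm_minus_commute)
    \<comment> \<open>the second difference is \<open>q t - q 0\<close>\<close>
    define q where "q = (\<lambda>\<rho>. f (x + \<rho> *\<^sub>R u + t *\<^sub>R v) - f (x + \<rho> *\<^sub>R u))"
    have fd: "(f has_derivative frechet_derivative f (at y)) (at y)" if "y \<in> S" for y
      using f[OF that] by (simp add: frechet_derivative_works)
    have dq: "(q has_real_derivative (A (x + \<rho> *\<^sub>R u + t *\<^sub>R v) - A (x + \<rho> *\<^sub>R u))) (at \<rho>)"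
      if "0 \<le> \<rho>" "\<rho> \<le> t" for \<rho>
    proof -
      have l1: "linear (frechet_derivative f (at (x + \<rho> *\<^sub>R u)))"
        "linear (frechet_derivative f (at (x + \<rho> *\<^sub>R u + t *\<^sub>R v)))"
        using inS[OF that] f linear_frechet_derivative by blast+
      have a: "((\<lambda>\<rho>. x + \<rho> *\<^sub>R u) has_derivative (\<lambda>h. h *\<^sub>R u)) (at \<rho>)"
        by (auto intro!: derivative_eq_intros)
      have b: "((\<lambda>\<rho>. x + \<rho> *\<^sub>R u + t *\<^sub>R v) has_derivative (\<lambda>h. h *\<^sub>R u)) (at \<rho>)"
        by (auto intro!: derivative_eq_intros)
      have "(q has_derivative (\<lambda>h. frechet_derivative f (at (x + \<rho> *\<^sub>R u + t *\<^sub>R v)) (h *\<^sub>R u)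
            - frechet_derivative f (at (x + \<rho> *\<^sub>R u)) (h *\<^sub>R u))) (at \<rho>)"
        unfolding q_def
        by (intro has_derivative_diff has_derivative_compose[OF a fd] has_derivative_compose[OF b fd] inS that)
      then show ?thesis
        unfolding has_field_derivative_def A_def
        by (rule has_derivative_eq_rhs) (auto simp: linear_scale[OF l1(1)] linear_scale[OF l1(2)] right_diff_distrib fun_eq_iff mult.commute[of "_ - _"])
    qed
    obtain \<rho> where \<rho>: "0 < \<rho>" "\<rho> < t" "q t - q 0 = (t - 0) * (A (x + \<rho> *\<^sub>R u + t *\<^sub>R v) - A (x + \<rho> *\<^sub>R u))"
      using MVT2[OF t(1), of q "\<lambda>\<rho>. A (x + \<rho> *\<^sub>R u + t *\<^sub>R v) - A (x + \<rho> *\<^sub>R u)", OF dq] by auto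
    define a where "a = x + \<rho> *\<^sub>R u + t *\<^sub>R v"
    define b where "b = x + \<rho> *\<^sub>R u"
    have ax: "a - x = \<rho> *\<^sub>R u + t *\<^sub>R v" and bx: "b - x = \<rho> *\<^sub>R u" by (auto simp: a_def b_def)
    have na: "norm (a - x) \<le> t * (norm u + norm v)" and nb: "norm (b - x) \<le> t * norm u"
      using small[of \<rho>] \<rho> by (auto simp: ax bx)
    have 1: "norm (A a - A x - A' (a - x)) \<le> e / (2 * L) * (t * (norm u + norm v))"
      using d(2)[of a] na tL le \<open>e / (2 * L) > 0\<close>
      by (smt (verit) mult_left_mono)
    have 2: "norm (A b - A x - A' (b - x)) \<le> e / (2 * L) * (t * norm u)"
      using d(2)[of b] nb tL le \<open>e / (2 * L) > 0\<close>
      by (smt (verit) mult_left_mono)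
    have 3: "A' (a - x) - A' (b - x) = t * A' v"
      by (simp add: ax bx A'.add A'.scaleR)
    have "\<bar>A a - A b - t * A' v\<bar> \<le> e / (2 * L) * (t * (norm u + norm v)) + e / (2 * L) * (t * norm u)"
      using 1 2 3 by (simp add: abs_le_iff)
    also have "\<dots> = e / (2 * L) * (t * (2 * norm u + norm v))"
      by (simp add: algebra_simps)
    also have "\<dots> \<le> e / (2 * L) * (t * L)"
      using t \<open>e / (2 * L) > 0\<close> by (intro mult_left_mono) (auto simp: L_def)
    also have "\<dots> = e * t / 2" using L by simp
    finally have 4: "\<bar>A a - A b - t * A' v\<bar> \<le> e * t / 2" .
    have 5: "f (x + t *\<^sub>R u + t *\<^sub>R v) - f (x + t *\<^sub>R u) - f (x + t *\<^sub>R v) + f x = t * (A a - A b)"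
      using \<rho>(3) by (simp add: q_def a_def b_def algebra_simps)
    have "t * (A a - A b) / t\<^sup>2 - A' v = (A a - A b - t * A' v) / t"
      using t by (simp add: field_simps power2_eq_square)
    then have "\<bar>t * (A a - A b) / t\<^sup>2 - A' v\<bar> \<le> e / 2"
      using 4 t by (simp only: abs_divide) (simp add: pos_divide_le_eq mult.commute)
    then show ?thesis using \<open>e > 0\<close> by (simp add: 5 dist_real_def)
  qed
  then show "\<forall>\<^sub>F t in at_right 0. dist ((f (x + t *\<^sub>R u + t *\<^sub>R v) - f (x + t *\<^sub>R u) - f (x + t *\<^sub>R v) + f x) / t\<^sup>2) (A' v) < e"
    using \<open>k > 0\<close> unfolding eventually_at_right_field by blast
qed

lemma second_derivative_symmetric_real:
  fixes f :: "'e::real_normed_vector \<Rightarrow> real"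
  assumes S: "open S" "x \<in> S"
    and f: "\<And>y. y \<in> S \<Longrightarrow> f differentiable (at y)"
    and A: "((\<lambda>y. frechet_derivative f (at y) u) has_derivative A') (at x)"
    and B: "((\<lambda>y. frechet_derivative f (at y) v) has_derivative B') (at x)"
  shows "A' v = B' u"
proof (rule tendsto_unique)
  show "((\<lambda>t. (f (x + t *\<^sub>R u + t *\<^sub>R v) - f (x + t *\<^sub>R u) - f (x + t *\<^sub>R v) + f x) / t\<^sup>2) \<longlongrightarrow> A' v) (at_right 0)"
    using second_difference_limit[OF S f A] by blast
  have "((\<lambda>t. (f (x + t *\<^sub>R v + t *\<^sub>R u) - f (x + t *\<^sub>R v) - f (x + t *\<^sub>R u) + f x) / t\<^sup>2) \<longlongrightarrow> B' u) (at_right 0)"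
    using second_difference_limit[OF S f B] by blast
  then show "((\<lambda>t. (f (x + t *\<^sub>R u + t *\<^sub>R v) - f (x + t *\<^sub>R u) - f (x + t *\<^sub>R v) + f x) / t\<^sup>2) \<longlongrightarrow> B' u) (at_right 0)"
    by (simp add: algebra_simps)
qed simp

lemma second_derivative_symmetric:
  fixes f :: "'e::real_normed_vector \<Rightarrow> 'f::euclidean_space"
  assumes S: "open S" "x \<in> S"
    and f: "\<And>y. y \<in> S \<Longrightarrow> f differentiable (at y)"
    and A: "(\<lambda>y. frechet_derivative f (at y) u) differentiable (at x)"
    and B: "(\<lambda>y. frechet_derivative f (at y) v) differentiable (at x)"
  shows "frechet_derivative (\<lambda>y. frechet_derivative f (at y) u) (at x) v =
    frechet_derivative (\<lambda>y. frechet_derivative f (at y) v) (at x) u"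
proof (rule euclidean_eqI)
  fix b :: 'f assume "b \<in> Basis"
  have d: "((\<lambda>z. f z \<bullet> b) has_derivative (\<lambda>h. frechet_derivative f (at y) h \<bullet> b)) (at y)" if "y \<in> S" for y
    using f[OF that] unfolding frechet_derivative_works by (rule has_derivative_inner_left)
  then have e: "frechet_derivative (\<lambda>z. f z \<bullet> b) (at y) = (\<lambda>h. frechet_derivative f (at y) h \<bullet> b)" if "y \<in> S" for y
    using that frechet_derivative_eqI by blast
  have *: "((\<lambda>y. frechet_derivative (\<lambda>z. f z \<bullet> b) (at y) w) has_derivative
      (\<lambda>h. frechet_derivative (\<lambda>y. frechet_derivative f (at y) w) (at x) h \<bullet> b)) (at x)"
    if "(\<lambda>y. frechet_derivative f (at y) w) differentiable (at x)" for w
  proof -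
    have "((\<lambda>y. frechet_derivative f (at y) w \<bullet> b) has_derivative
      (\<lambda>h. frechet_derivative (\<lambda>y. frechet_derivative f (at y) w) (at x) h \<bullet> b)) (at x)"
      using that unfolding frechet_derivative_works by (rule has_derivative_inner_left)
    then show ?thesis
      by (rule has_derivative_transform_within_open[OF _ S]) (simp add: e)
  qed
  show "frechet_derivative (\<lambda>y. frechet_derivative f (at y) u) (at x) v \<bullet> b =
    frechet_derivative (\<lambda>y. frechet_derivative f (at y) v) (at x) u \<bullet> b"
    by (rule second_derivative_symmetric_real[OF S _ *[OF A] *[OF B]])
      (use d differentiable_def in blast)
qed

text \<open>
  The linear maps form a closed subspace, so a family of them can only change within it. This makes
  derivatives of coordinate tensors multilinear again.
\<close>

lemma linear_derivative_of_family:
  assumes lin: "\<forall>\<^sub>F y in nhds x. linear (A y)"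
    and A: "\<And>v. ((\<lambda>y. A y v) has_derivative (\<lambda>h. A' h v)) (at x)"
  shows "linear (A' h)"
proof (rule linearI)
  fix a b :: 'b and c :: real
  have "((\<lambda>y. A y a + A y b) has_derivative (\<lambda>h. A' h (a + b))) (at x)"
    by (rule has_derivative_cong_ev[OF A]) (use lin in eventually_elim, simp add: linear_add)
  moreover have "((\<lambda>y. A y a + A y b) has_derivative (\<lambda>h. A' h a + A' h b)) (at x)"
    by (intro has_derivative_add A)
  ultimately have "(\<lambda>h. A' h (a + b)) = (\<lambda>h. A' h a + A' h b)" by (rule has_derivative_unique)
  then show "A' h (a + b) = A' h a + A' h b" by meson
  have "((\<lambda>y. c *\<^sub>R A y a) has_derivative (\<lambda>h. A' h (c *\<^sub>R a))) (at x)"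
    by (rule has_derivative_cong_ev[OF A]) (use lin in eventually_elim, simp add: linear_scale)
  moreover have "((\<lambda>y. c *\<^sub>R A y a) has_derivative (\<lambda>h. c *\<^sub>R A' h a)) (at x)"
    by (intro has_derivative_scaleR_right A)
  ultimately have "(\<lambda>h. A' h (c *\<^sub>R a)) = (\<lambda>h. c *\<^sub>R A' h a)" by (rule has_derivative_unique)
  then show "A' h (c *\<^sub>R a) = c *\<^sub>R A' h a" by meson
qed

text \<open>
  The product rule for applying a moving linear map to a moving vector. Expanding in the finite
  basis reduces it to pointwise differentiability of the family, without a norm on the space of
  linear maps.
\<close>

lemma has_derivative_linear_family:
  fixes A :: "'t::real_normed_vector \<Rightarrow> 'e::euclidean_space \<Rightarrow> 'b::real_normed_vector"
  assumes lin: "\<forall>\<^sub>F y in nhds x. linear (A y)"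
    and A: "\<And>v. ((\<lambda>y. A y v) has_derivative (\<lambda>h. A' h v)) (at x)"
    and u: "(u has_derivative u') (at x)"
  shows "((\<lambda>y. A y (u y)) has_derivative (\<lambda>h. A' h (u x) + A x (u' h))) (at x)"
proof -
  have rep: "L v = (\<Sum>b\<in>Basis. (v \<bullet> b) *\<^sub>R L b)" if "linear L" for v and L :: "'e \<Rightarrow> 'b"
  proof -
    have "L v = L (\<Sum>b\<in>Basis. (v \<bullet> b) *\<^sub>R b)" by (simp add: euclidean_representation)
    then show ?thesis using that by (simp add: linear_sum linear_scale)
  qed
  have linx: "linear (A x)" using lin eventually_nhds_x_imp_x by blast
  have "((\<lambda>y. \<Sum>b\<in>Basis. (u y \<bullet> b) *\<^sub>R A y b) has_derivative
      (\<lambda>h. \<Sum>b\<in>Basis. (u x \<bullet> b) *\<^sub>R A' h b + (u' h \<bullet> b) *\<^sub>R A x b)) (at x)"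
    by (intro has_derivative_sum has_derivative_scaleR has_derivative_inner_left u A)
  then have "((\<lambda>y. A y (u y)) has_derivative
      (\<lambda>h. \<Sum>b\<in>Basis. (u x \<bullet> b) *\<^sub>R A' h b + (u' h \<bullet> b) *\<^sub>R A x b)) (at x)"
    by (rule has_derivative_cong_ev) (use lin in eventually_elim, simp add: rep[symmetric])
  then show ?thesis
    by (rule has_derivative_eq_rhs)
      (auto simp: sum.distrib rep[OF linx, where v = "u' _"] rep[OF linear_derivative_of_family[OF lin A], where v = "u x"])
qed


section \<open>Inner products and the Koszul formula\<close>

definition inner_form :: "('e::euclidean_space \<Rightarrow> 'e \<Rightarrow> real) \<Rightarrow> bool"
  where "inner_form B \<longleftrightarrow> bilinear B \<and> (\<forall>a b. B a b = B b a) \<and> (\<forall>a. a \<noteq> 0 \<longrightarrow> B a a > 0)"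

lemma inner_form_ext:
  assumes B: "inner_form B" and eq: "\<And>b. B a b = B a' b"
  shows "a = a'"
proof (rule ccontr)
  assume "a \<noteq> a'"
  then have "B (a - a') (a - a') > 0" using B by (simp add: inner_form_def)
  moreover have "B (a - a') (a - a') = 0"
    using B eq[of "a - a'"] bilinear_lsub[of B a a' "a - a'"] by (simp add: inner_form_def)
  ultimately show False by simp
qed

text \<open>
  A nondegenerate form on a finite-dimensional space makes \<open>a \<mapsto> B a\<close> injective, hence surjective
  onto the linear functionals.
\<close>

lemma inner_form_riesz:
  fixes B :: "'e::euclidean_space \<Rightarrow> 'e \<Rightarrow> real"
  assumes B: "inner_form B" and L: "linear L"
  shows "\<exists>a. \<forall>b. B a b = L b"
proof -
  have bil: "bilinear B" using B by (simp add: inner_form_def)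
  define T where "T = (\<lambda>a. \<Sum>b\<in>Basis. B a b *\<^sub>R b)"
  have T: "T a \<bullet> b = B a b" if "b \<in> Basis" for a b
    using that by (simp add: T_def inner_sum_left inner_Basis if_distrib cong: if_cong)
  have lB: "linear (B a)" "linear (\<lambda>a. B a b)" for a b
    using bil by (auto simp: bilinear_def)
  have "linear T"
    by (rule linearI)
      (simp_all add: T_def linear_add[OF lB(2)] linear_scale[OF lB(2)] scaleR_add_left sum.distrib scaleR_sum_right)
  moreover have "inj T"
  proof (rule injI)
    fix a a' assume "T a = T a'"
    then have eq: "B a b = B a' b" if "b \<in> Basis" for b using T[OF that] by metis
    have "B a = B a'" using linear_eq_stdbasis[OF lB(1) lB(1)] eq by blast
    then show "a = a'" using inner_form_ext[OF B] by metis
  qed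
  ultimately have "surj T" by (simp add: linear_inj_imp_surj)
  then obtain a where a: "T a = (\<Sum>b\<in>Basis. L b *\<^sub>R b)" by (metis surjD)
  have "B a b = L b" if "b \<in> Basis" for b
    using T[OF that, of a] that
    by (simp add: a inner_sum_left inner_Basis if_distrib cong: if_cong)
  then have "B a = L" using linear_eq_stdbasis[OF lB(1) L] by blast
  then show ?thesis by auto
qed

text \<open>
  Permuting the arguments cyclically in the metric condition and using that \<open>\<Gamma>\<close> is symmetric
  isolates \<open>B (\<Gamma> a b) c\<close>. This determines \<open>\<Gamma>\<close>, and conversely the formula defines a connection
  with both properties, so the definite description denotes.
\<close>

lemma koszul:
  fixes B :: "'e::euclidean_space \<Rightarrow> 'e \<Rightarrow> real" and d :: "'e \<Rightarrow> 'e \<Rightarrow> 'e \<Rightarrow> real"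
  assumes B: "inner_form B"
    and lin: "\<And>b c. linear (\<lambda>a. d a b c)" "\<And>a c. linear (\<lambda>b. d a b c)"
    and sym: "\<And>a b c. d a b c = d a c b"
  defines "P \<equiv> \<lambda>\<Gamma>. bilinear \<Gamma> \<and> (\<forall>a b. \<Gamma> a b = \<Gamma> b a) \<and>
    (\<forall>a b c. d a b c = B (\<Gamma> a b) c + B b (\<Gamma> a c))"
  shows "2 * B ((THE \<Gamma>. P \<Gamma>) a b) c = d a b c + d b a c - d c a b"
proof -
  have bil: "bilinear B" and Bsym: "B a b = B b a" for a b using B by (auto simp: inner_form_def)
  have lin3: "linear (\<lambda>c. d a b c)" for a b using lin(2)[of a b] sym[of a b] by simp
  have K: "2 * B (\<Gamma> a b) c = d a b c + d b a c - d c a b" if "P \<Gamma>" for \<Gamma> a b c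
  proof -
    have "d a b c = B (\<Gamma> a b) c + B b (\<Gamma> a c)" "d b a c = B (\<Gamma> b a) c + B a (\<Gamma> b c)"
       "d c a b = B (\<Gamma> c a) b + B a (\<Gamma> c b)" "\<Gamma> a b = \<Gamma> b a" "\<Gamma> a c = \<Gamma> c a" "\<Gamma> c b = \<Gamma> b c"
      using that unfolding P_def by blast+
    then show ?thesis using Bsym[of b "\<Gamma> c a"] by simp
  qed
  have "\<exists>g. \<forall>c. B g c = (d a b c + d b a c - d c a b) / 2" for a b
  proof (rule inner_form_riesz[OF B])
    have "linear (\<lambda>c. (1/2) *\<^sub>R (d a b c + d b a c - d c a b))"
      by (intro linear_compose_scale_right linear_compose_sub linear_compose_add lin lin3)
    then show "linear (\<lambda>c. (d a b c + d b a c - d c a b) / 2)" by simp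
  qed
  then obtain \<Gamma> where \<Gamma>: "\<And>a b c. B (\<Gamma> a b) c = (d a b c + d b a c - d c a b) / 2" by metis
  have \<Gamma>sym: "\<Gamma> a b = \<Gamma> b a" for a b
    by (rule inner_form_ext[OF B]) (simp add: \<Gamma> sym[of _ a b])
  have lin\<Gamma>: "linear (\<Gamma> a)" for a
  proof (rule linearI)
    show "\<Gamma> a (b + b') = \<Gamma> a b + \<Gamma> a b'" for b b'
      by (rule inner_form_ext[OF B])
        (simp add: bilinear_ladd[OF bil] \<Gamma> linear_add[OF lin(1)] linear_add[OF lin(2)] linear_add[OF lin3] field_simps)
    show "\<Gamma> a (r *\<^sub>R b) = r *\<^sub>R \<Gamma> a b" for r b
      by (rule inner_form_ext[OF B])
        (simp add: bilinear_lmul[OF bil] \<Gamma> linear_scale[OF lin(1)] linear_scale[OF lin(2)] linear_scale[OF lin3] algebra_simps add_divide_distrib diff_divide_distrib)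
  qed
  have "P \<Gamma>"
    unfolding P_def bilinear_def
  proof (intro conjI allI)
    show "linear (\<Gamma> a)" for a by fact
    show "linear (\<lambda>a. \<Gamma> a b)" for b using lin\<Gamma>[of b] \<Gamma>sym by (metis (no_types, lifting) ext)
    show "\<Gamma> a b = \<Gamma> b a" for a b by fact
    show "d a b c = B (\<Gamma> a b) c + B b (\<Gamma> a c)" for a b c
      unfolding Bsym[of b] \<Gamma> using sym[of a b c] sym[of b a c] sym[of c a b] by (simp add: field_simps)
  qed
  moreover have "\<Gamma>' = \<Gamma>" if "P \<Gamma>'" for \<Gamma>'
    using K[OF that] K[OF \<open>P \<Gamma>\<close>] by (intro ext inner_form_ext[OF B]) (metis mult_cancel_left zero_neq_numeral)
  ultimately have "P (THE \<Gamma>. P \<Gamma>)" by (rule theI)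
  then show ?thesis by (rule K)
qed


section \<open>Tangent vectors and velocities in an atlas\<close>

abbreviation transition :: "('i, 'a, 'e) manifold \<Rightarrow> 'i \<Rightarrow> 'i \<Rightarrow> 'e \<Rightarrow> 'e"
  where "transition N i j \<equiv> chart N j \<circ> chart_inv N i"

abbreviation transition_deriv ::
    "('i, 'a, 'e::euclidean_space) manifold \<Rightarrow> 'i \<Rightarrow> 'i \<Rightarrow> 'a \<Rightarrow> 'e \<Rightarrow> 'e"
  where "transition_deriv N i j p \<equiv> frechet_derivative (transition N i j) (at (chart N i p))"

text \<open>
  Tangent vectors and velocities behave as expected as soon as the chart changes are differentiable.
  Asking for no more makes the results apply to the tangent bundle as well as to the manifold.
\<close>

locale differentiable_atlas =
  fixes N :: "('i, 'a, 'e::euclidean_space) manifold"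
  assumes inj_chart: "i \<in> chart_index N \<Longrightarrow> inj_on (chart N i) (chart_dom N i)"
    and open_overlap: "i \<in> chart_index N \<Longrightarrow> j \<in> chart_index N \<Longrightarrow>
      open (chart N i ` (chart_dom N i \<inter> chart_dom N j))"
    and transition_differentiable: "i \<in> charts_at N p \<Longrightarrow> j \<in> charts_at N p \<Longrightarrow>
      transition N i j differentiable (at (chart N i p))"
begin

lemma charts_atD: "i \<in> charts_at N p \<Longrightarrow> i \<in> chart_index N" "i \<in> charts_at N p \<Longrightarrow> p \<in> chart_dom N i"
  by (auto simp: charts_at_def)

lemma points_iff: "p \<in> points N \<longleftrightarrow> (\<exists>i. i \<in> charts_at N p)"
  by (auto simp: points_def charts_at_def)

lemma chart_at: "p \<in> points N \<Longrightarrow> chart_at N p \<in> charts_at N p"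
  unfolding points_iff chart_at_def by (rule someI_ex)

lemma chart_inv_chart: "i \<in> charts_at N p \<Longrightarrow> chart_inv N i (chart N i p) = p"
  by (simp add: chart_inv_def charts_at_def inj_chart)

lemma eventually_overlap:
  assumes "i \<in> charts_at N p" "j \<in> charts_at N p"
  shows "\<forall>\<^sub>F y in nhds (chart N i p). y \<in> chart N i ` (chart_dom N i \<inter> chart_dom N j)"
  using assms open_overlap by (intro eventually_nhds_in_open) (auto simp: charts_at_def)

lemma eventually_chart_image:
  assumes "i \<in> charts_at N p"
  shows "\<forall>\<^sub>F y in nhds (chart N i p). i \<in> charts_at N (chart_inv N i y) \<and> chart N i (chart_inv N i y) = y"
  using eventually_overlap[OF assms assms]
proof eventually_elim
  case (elim y)
  then obtain q where "q \<in> chart_dom N i" "y = chart N i q" by auto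
  then have "i \<in> charts_at N q" using assms by (auto simp: charts_at_def)
  then show ?case using chart_inv_chart \<open>y = _\<close> by auto
qed

lemma has_derivative_transition:
  "i \<in> charts_at N p \<Longrightarrow> j \<in> charts_at N p \<Longrightarrow>
    (transition N i j has_derivative transition_deriv N i j p) (at (chart N i p))"
  using transition_differentiable frechet_derivative_works by blast

lemma linear_transition_deriv:
  "i \<in> charts_at N p \<Longrightarrow> j \<in> charts_at N p \<Longrightarrow> linear (transition_deriv N i j p)"
  by (simp add: linear_frechet_derivative transition_differentiable)

lemma transition_deriv_refl:
  assumes "i \<in> charts_at N p"
  shows "transition_deriv N i i p a = a"
proof -
  have "((\<lambda>y. y) has_derivative (\<lambda>h. h)) (at (chart N i p))" by (rule has_derivative_ident)
  then have "(transition N i i has_derivative (\<lambda>h. h)) (at (chart N i p))"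
    by (rule has_derivative_cong_ev) (use eventually_chart_image[OF assms] in eventually_elim, simp)
  then show ?thesis by (simp add: frechet_derivative_eqI)
qed

lemma transition_deriv_trans:
  assumes "i \<in> charts_at N p" "j \<in> charts_at N p" "k \<in> charts_at N p"
  shows "transition_deriv N j k p (transition_deriv N i j p a) = transition_deriv N i k p a"
proof -
  have "(transition N j k has_derivative transition_deriv N j k p) (at (transition N i j (chart N i p)))"
    using assms has_derivative_transition by (simp add: chart_inv_chart)
  from has_derivative_compose[OF has_derivative_transition[OF assms(1,2)] this]
  have "(transition N i k has_derivative
     (\<lambda>h. transition_deriv N j k p (transition_deriv N i j p h))) (at (chart N i p))"
  proof (rule has_derivative_cong_ev)
    show "\<forall>\<^sub>F y in nhds (chart N i p). transition N j k (transition N i j y) = transition N i k y"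
      using eventually_overlap[OF assms(1,2)]
    proof eventually_elim
      case (elim y)
      then obtain q where q: "q \<in> chart_dom N i" "q \<in> chart_dom N j" "y = chart N i q" by auto
      then have "i \<in> charts_at N q" "j \<in> charts_at N q" using assms by (auto simp: charts_at_def)
      then show ?case using chart_inv_chart q by auto
    qed
  qed
  then show ?thesis by (simp add: frechet_derivative_eqI)
qed

lemma coord_vector_nth: "j \<in> charts_at N p \<Longrightarrow> coord_vector N i p a j = transition_deriv N i j p a"
  by (simp add: coord_vector_def)

lemma coord_vector_self: "i \<in> charts_at N p \<Longrightarrow> coord_vector N i p a i = a"
  by (simp add: coord_vector_def transition_deriv_refl)

lemma coord_vector_tangent: "i \<in> charts_at N p \<Longrightarrow> coord_vector N i p a \<in> tangent_space N p"
  by (simp add: tangent_space_def coord_vector_def transition_deriv_trans)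

lemma tangent_space_nth:
  "v \<in> tangent_space N p \<Longrightarrow> i \<in> charts_at N p \<Longrightarrow> j \<in> charts_at N p \<Longrightarrow>
    transition_deriv N i j p (v i) = v j"
  unfolding tangent_space_def mem_Collect_eq by (rule sym) blast

lemma tangent_space_zero: "v \<in> tangent_space N p \<Longrightarrow> j \<notin> charts_at N p \<Longrightarrow> v j = 0"
  unfolding tangent_space_def by blast

lemma coord_vector_eq: "v \<in> tangent_space N p \<Longrightarrow> i \<in> charts_at N p \<Longrightarrow> coord_vector N i p (v i) = v"
  by (rule ext) (simp add: coord_vector_def tangent_space_nth tangent_space_zero)

lemma tangent_space_eqI:
  "v \<in> tangent_space N p \<Longrightarrow> w \<in> tangent_space N p \<Longrightarrow> i \<in> charts_at N p \<Longrightarrow> v i = w i \<Longrightarrow> v = w"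
  using coord_vector_eq by metis

lemma coord_vector_change:
  "i \<in> charts_at N p \<Longrightarrow> j \<in> charts_at N p \<Longrightarrow>
    coord_vector N j p (transition_deriv N i j p a) = coord_vector N i p a"
  by (auto simp: coord_vector_def transition_deriv_trans)

lemma coord_vector_linear:
  assumes "i \<in> charts_at N p"
  shows "coord_vector N i p (c *\<^sub>R a + b) = (\<lambda>j. c *\<^sub>R coord_vector N i p a j + coord_vector N i p b j)"
  by (rule ext) (auto simp: coord_vector_def linear_add linear_scale linear_transition_deriv[OF assms])

lemma scaleR_tangent:
  "v \<in> tangent_space N p \<Longrightarrow> (\<lambda>i. c *\<^sub>R v i) \<in> tangent_space N p"
  by (subst tangent_space_def)
    (simp add: linear_scale linear_transition_deriv tangent_space_nth tangent_space_zero)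

text \<open>
  Continuity in the chart \<open>i\<close> keeps the curve in the overlap with any other chart around the point,
  and there the chart change carries the derivative over by the chain rule.
\<close>

lemma has_velocity_from_chart:
  assumes i: "i \<in> charts_at N (c t)" and ev: "\<forall>\<^sub>F s in nhds t. c s \<in> chart_dom N i"
    and d: "((\<lambda>s. chart N i (c s)) has_vector_derivative a) (at t)"
  shows "has_velocity N c t (coord_vector N i (c t) a)"
  unfolding has_velocity_def
proof (intro conjI ballI)
  show "c t \<in> points N" using i points_iff by blast
  show "coord_vector N i (c t) a \<in> tangent_space N (c t)" by (rule coord_vector_tangent[OF i])
  fix j assume j: "j \<in> charts_at N (c t)"
  have "isCont (\<lambda>s. chart N i (c s)) t" using d has_vector_derivative_continuous by blast
  then have "filterlim (\<lambda>s. chart N i (c s)) (nhds (chart N i (c t))) (at t)" by (simp add: isCont_def)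
  then have lim: "filterlim (\<lambda>s. chart N i (c s)) (nhds (chart N i (c t))) (nhds t)"
    using tendsto_at_iff_tendsto_nhds[of "\<lambda>s. chart N i (c s)" t] by simp
  show ev2: "\<forall>\<^sub>F s in nhds t. c s \<in> chart_dom N j"
    using eventually_compose_filterlim[OF eventually_overlap[OF i j] lim] ev
  proof eventually_elim
    case (elim s)
    then show ?case using inj_chart[OF charts_atD(1)[OF i]] by (auto dest: inj_onD)
  qed
  have "((\<lambda>s. transition N i j (chart N i (c s))) has_derivative
     (\<lambda>h. transition_deriv N i j (c t) (h *\<^sub>R a))) (at t)"
    using has_derivative_compose[OF d[unfolded has_vector_derivative_def] has_derivative_transition[OF i j]] .
  then have "((\<lambda>s. chart N j (c s)) has_derivative
     (\<lambda>h. transition_deriv N i j (c t) (h *\<^sub>R a))) (at t)"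
    by (rule has_derivative_cong_ev)
      (use ev in eventually_elim, use chart_inv_chart i in \<open>auto simp: charts_at_def\<close>)
  then show "((\<lambda>s. chart N j (c s)) has_vector_derivative coord_vector N i (c t) a j) (at t)"
    unfolding has_vector_derivative_def
    by (rule has_derivative_eq_rhs) (simp add: coord_vector_nth[OF j] linear_scale[OF linear_transition_deriv[OF i j]])
qed

lemma has_velocity_unique:
  assumes "has_velocity N c t \<xi>" "has_velocity N c t \<zeta>"
  shows "\<xi> = \<zeta>"
proof -
  obtain i where i: "i \<in> charts_at N (c t)" using assms(1) unfolding has_velocity_def points_iff by blast
  then have "\<xi> i = \<zeta> i"
    using assms unfolding has_velocity_def by (blast intro: vector_derivative_unique_at)
  then show ?thesis using assms i tangent_space_eqI unfolding has_velocity_def by blast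
qed

lemma velocity_eqI: "has_velocity N c t \<xi> \<Longrightarrow> velocity N c t = \<xi>"
  unfolding velocity_def using has_velocity_unique by blast

lemma has_velocityD:
  assumes "has_velocity N c t \<xi>"
  shows "c t \<in> points N" "\<xi> \<in> tangent_space N (c t)"
    "i \<in> charts_at N (c t) \<Longrightarrow> \<forall>\<^sub>F s in nhds t. i \<in> charts_at N (c s)"
    "i \<in> charts_at N (c t) \<Longrightarrow> ((\<lambda>s. chart N i (c s)) has_vector_derivative \<xi> i) (at t)"
    "i \<in> charts_at N (c t) \<Longrightarrow> isCont (\<lambda>s. chart N i (c s)) t"
proof -
  show "c t \<in> points N" "\<xi> \<in> tangent_space N (c t)"
    "i \<in> charts_at N (c t) \<Longrightarrow> \<forall>\<^sub>F s in nhds t. i \<in> charts_at N (c s)"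
    "i \<in> charts_at N (c t) \<Longrightarrow> ((\<lambda>s. chart N i (c s)) has_vector_derivative \<xi> i) (at t)"
    using assms by (auto simp: has_velocity_def charts_at_def)
  then show "i \<in> charts_at N (c t) \<Longrightarrow> isCont (\<lambda>s. chart N i (c s)) t"
    using has_vector_derivative_continuous by blast
qed

lemma has_velocity_cong_ev:
  assumes "has_velocity N c t \<xi>" and ev: "\<forall>\<^sub>F s in nhds t. c s = c' s"
  shows "has_velocity N c' t \<xi>"
proof -
  have eq: "c' t = c t" using eventually_nhds_x_imp_x[OF ev] by simp
  show ?thesis
    unfolding has_velocity_def eq
  proof (intro conjI ballI)
    show "c t \<in> points N" "\<xi> \<in> tangent_space N (c t)" using has_velocityD[OF assms(1)] by auto
    fix i assume i: "i \<in> charts_at N (c t)"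
    have "\<forall>\<^sub>F s in nhds t. c s \<in> chart_dom N i" using assms(1) i by (simp add: has_velocity_def)
    then show "\<forall>\<^sub>F s in nhds t. c' s \<in> chart_dom N i" using ev by eventually_elim simp
    have "\<forall>\<^sub>F s in nhds t. chart N i (c s) = chart N i (c' s)" using ev by eventually_elim simp
    then show "((\<lambda>s. chart N i (c' s)) has_vector_derivative \<xi> i) (at t)"
      using has_derivative_cong_ev[OF has_velocityD(4)[OF assms(1) i, unfolded has_vector_derivative_def]]
      unfolding has_vector_derivative_def by simp
  qed
qed

lemma has_velocity_reparametrize:
  assumes c: "has_velocity N c (r t) \<xi>" and r: "(r has_real_derivative k) (at t)"
  shows "has_velocity N (c \<circ> r) t (\<lambda>i. k *\<^sub>R \<xi> i)"
  unfolding has_velocity_def o_def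
proof (intro conjI ballI)
  show "c (r t) \<in> points N" "(\<lambda>i. k *\<^sub>R \<xi> i) \<in> tangent_space N (c (r t))"
    using has_velocityD(1,2)[OF c] by (auto intro: scaleR_tangent)
  fix i assume i: "i \<in> charts_at N (c (r t))"
  have "isCont r t" using r DERIV_isCont by blast
  then have "filterlim r (nhds (r t)) (nhds t)"
    using tendsto_at_iff_tendsto_nhds[of r t] by (simp add: isCont_def)
  then show "\<forall>\<^sub>F s in nhds t. c (r s) \<in> chart_dom N i"
    using c i eventually_compose_filterlim unfolding has_velocity_def by fast
  show "((\<lambda>s. chart N i (c (r s))) has_vector_derivative k *\<^sub>R \<xi> i) (at t)"
    using vector_diff_chain_at[OF r[unfolded has_real_derivative_iff_has_vector_derivative] has_velocityD(4)[OF c i]]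
    by (simp add: o_def)
qed

end


section \<open>The tangent bundle of a smooth manifold\<close>

lemma smooth_on_differentiable: "smooth_on S f \<Longrightarrow> x \<in> S \<Longrightarrow> f differentiable (at x)"
  unfolding smooth_on_def using Ck_on.simps(2)[of 0 S f] by blast

lemma smooth_on_derivative:
  "smooth_on S f \<Longrightarrow> smooth_on S (\<lambda>x. frechet_derivative f (at x) v)"
  unfolding smooth_on_def using Ck_on.simps(2)[of _ S f] by blast

locale smooth_atlas =
  fixes M :: "('i, 'a, 'e::euclidean_space) manifold"
  assumes smooth_manifold: "smooth_manifold M"

sublocale smooth_atlas \<subseteq> differentiable_atlas M
proof
  show "i \<in> chart_index M \<Longrightarrow> inj_on (chart M i) (chart_dom M i)" for i
    using smooth_manifold by (simp add: smooth_manifold_def)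
  show "i \<in> chart_index M \<Longrightarrow> j \<in> chart_index M \<Longrightarrow>
      open (chart M i ` (chart_dom M i \<inter> chart_dom M j))" for i j
    using smooth_manifold by (simp add: smooth_manifold_def)
  show "i \<in> charts_at M p \<Longrightarrow> j \<in> charts_at M p \<Longrightarrow>
      transition M i j differentiable (at (chart M i p))" for i j p
    using smooth_manifold unfolding smooth_manifold_def charts_at_def
    by (intro smooth_on_differentiable[of "chart M i ` (chart_dom M i \<inter> chart_dom M j)"]) auto
qed

context smooth_atlas
begin

definition transition_deriv2 :: "'i \<Rightarrow> 'i \<Rightarrow> 'a \<Rightarrow> 'e \<Rightarrow> 'e \<Rightarrow> 'e"
  where "transition_deriv2 i j p u v =
    frechet_derivative (\<lambda>y. frechet_derivative (transition M i j) (at y) v) (at (chart M i p)) u"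

lemma smooth_transition:
  "i \<in> charts_at M p \<Longrightarrow> j \<in> charts_at M p \<Longrightarrow>
    smooth_on (chart M i ` (chart_dom M i \<inter> chart_dom M j)) (transition M i j)"
  using smooth_manifold unfolding smooth_manifold_def charts_at_def by simp

lemma has_derivative_transition_deriv:
  assumes "i \<in> charts_at M p" "j \<in> charts_at M p"
  shows "((\<lambda>y. frechet_derivative (transition M i j) (at y) v) has_derivative
    (\<lambda>u. transition_deriv2 i j p u v)) (at (chart M i p))"
proof -
  have "(\<lambda>y. frechet_derivative (transition M i j) (at y) v) differentiable (at (chart M i p))"
    using assms
    by (intro smooth_on_differentiable[OF smooth_on_derivative[OF smooth_transition[OF assms]]])
      (auto simp: charts_at_def)
  then show ?thesis unfolding frechet_derivative_works transition_deriv2_def by simp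
qed

lemma eventually_linear_transition_deriv:
  assumes "i \<in> charts_at M p" "j \<in> charts_at M p"
  shows "\<forall>\<^sub>F y in nhds (chart M i p). linear (frechet_derivative (transition M i j) (at y))"
  using eventually_overlap[OF assms]
  by eventually_elim
    (rule linear_frechet_derivative, rule smooth_on_differentiable[OF smooth_transition[OF assms]])

lemma transition_deriv2_sym:
  assumes "i \<in> charts_at M p" "j \<in> charts_at M p"
  shows "transition_deriv2 i j p u v = transition_deriv2 i j p v u"
  unfolding transition_deriv2_def
proof (rule second_derivative_symmetric)
  show "open (chart M i ` (chart_dom M i \<inter> chart_dom M j))"
    "chart M i p \<in> chart M i ` (chart_dom M i \<inter> chart_dom M j)"
    using assms open_overlap by (auto simp: charts_at_def)
  show "transition M i j differentiable (at y)"
    if "y \<in> chart M i ` (chart_dom M i \<inter> chart_dom M j)" for y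
    using smooth_on_differentiable[OF smooth_transition[OF assms] that] .
  have d: "(\<lambda>y. frechet_derivative (transition M i j) (at y) w) differentiable at (chart M i p)" for w
    using has_derivative_transition_deriv[OF assms] differentiable_def by blast
  show "(\<lambda>y. frechet_derivative (transition M i j) (at y) v) differentiable at (chart M i p)"
    "(\<lambda>y. frechet_derivative (transition M i j) (at y) u) differentiable at (chart M i p)"
    by (rule d)+
qed

abbreviation "TM \<equiv> tangent_bundle M"

lemma tangent_bundle_simps:
  "chart_index TM = chart_index M"
  "chart_dom TM i = {(p, v). p \<in> chart_dom M i \<and> v \<in> tangent_space M p}"
  "chart TM i w = (chart M i (fst w), snd w i)"
  by (auto simp: tangent_bundle_def split: prod.splits)

lemma charts_at_bundle:
  "charts_at TM w = (if snd w \<in> tangent_space M (fst w) then charts_at M (fst w) else {})"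
  by (auto simp: charts_at_def tangent_bundle_simps)

lemma inj_chart_bundle:
  assumes "i \<in> chart_index M"
  shows "inj_on (chart TM i) (chart_dom TM i)"
proof (rule inj_onI)
  fix w z assume w: "w \<in> chart_dom TM i" and z: "z \<in> chart_dom TM i" and eq: "chart TM i w = chart TM i z"
  have "fst w = fst z" using w z eq inj_chart[OF assms] by (auto simp: tangent_bundle_simps dest: inj_onD)
  moreover have "i \<in> charts_at M (fst w)" using w assms by (auto simp: tangent_bundle_simps charts_at_def)
  ultimately have "snd w = snd z"
    using tangent_space_eqI[of "snd w" "fst w" "snd z" i] w z eq by (auto simp: tangent_bundle_simps)
  with \<open>fst w = fst z\<close> show "w = z" by (simp add: prod_eq_iff)
qed

lemma bundle_overlap_image:
  assumes "i \<in> chart_index M" "j \<in> chart_index M"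
  shows "chart TM i ` (chart_dom TM i \<inter> chart_dom TM j) =
    chart M i ` (chart_dom M i \<inter> chart_dom M j) \<times> UNIV"
proof
  show "chart TM i ` (chart_dom TM i \<inter> chart_dom TM j) \<subseteq> chart M i ` (chart_dom M i \<inter> chart_dom M j) \<times> UNIV"
    by (auto simp: tangent_bundle_simps)
  show "chart M i ` (chart_dom M i \<inter> chart_dom M j) \<times> UNIV \<subseteq> chart TM i ` (chart_dom TM i \<inter> chart_dom TM j)"
  proof clarify
    fix p a assume p: "p \<in> chart_dom M i" "p \<in> chart_dom M j"
    then have "i \<in> charts_at M p" using assms by (simp add: charts_at_def)
    then have "(p, coord_vector M i p a) \<in> chart_dom TM i \<inter> chart_dom TM j"
      "chart TM i (p, coord_vector M i p a) = (chart M i p, a)"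
      using p by (auto simp: tangent_bundle_simps coord_vector_tangent coord_vector_self)
    then show "(chart M i p, a) \<in> chart TM i ` (chart_dom TM i \<inter> chart_dom TM j)" by (metis image_eqI)
  qed
qed

lemma chart_inv_bundle:
  assumes "i \<in> charts_at M p"
  shows "chart_inv TM i (chart M i p, a) = (p, coord_vector M i p a)"
proof -
  have "(p, coord_vector M i p a) \<in> chart_dom TM i"
    "chart TM i (p, coord_vector M i p a) = (chart M i p, a)"
    using assms by (auto simp: tangent_bundle_simps coord_vector_tangent coord_vector_self charts_at_def)
  then show ?thesis
    unfolding chart_inv_def
    using inv_into_f_f[OF inj_chart_bundle[OF charts_atD(1)[OF assms]]] by metis
qed

lemma eventually_nhds_fst:
  assumes "\<forall>\<^sub>F y in nhds x. P y"
  shows "\<forall>\<^sub>F z in nhds (x, a). P (fst z)"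
  using eventually_compose_filterlim[OF assms tendsto_fst[OF filterlim_ident, of "(x, a)", simplified]] .

lemma eventually_chart_image_bundle:
  assumes "i \<in> charts_at M p"
  shows "\<forall>\<^sub>F z in nhds (chart M i p, a). \<exists>q. i \<in> charts_at M q \<and> fst z = chart M i q"
  using eventually_nhds_fst[OF eventually_chart_image[OF assms]]
  by eventually_elim metis

text \<open>
  The chart change of the tangent bundle is \<open>(y, a) \<mapsto> (\<phi> y, D\<phi>(y) a)\<close>. Its derivative contains the
  second derivative of \<open>\<phi>\<close>, which is why accelerations do not transform as vectors.
\<close>

lemma has_derivative_bundle_transition:
  assumes ij: "i \<in> charts_at M p" "j \<in> charts_at M p"
  shows "(transition TM i j has_derivative
    (\<lambda>h. (transition_deriv M i j p (fst h),
       transition_deriv2 i j p (fst h) a + transition_deriv M i j p (snd h)))) (at (chart M i p, a))"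
proof -
  have fst: "(fst has_derivative fst) (at (chart M i p, a))"
    and snd: "(snd has_derivative snd) (at (chart M i p, a))" by (auto intro!: has_derivative_fst has_derivative_snd has_derivative_ident)
  have 1: "((\<lambda>z. transition M i j (fst z)) has_derivative (\<lambda>h. transition_deriv M i j p (fst h))) (at (chart M i p, a))"
    using has_derivative_compose[OF fst, of "transition M i j"] has_derivative_transition[OF ij] by simp
  have 2: "((\<lambda>z. frechet_derivative (transition M i j) (at (fst z)) v) has_derivative
      (\<lambda>h. transition_deriv2 i j p (fst h) v)) (at (chart M i p, a))" for v
    by (rule has_derivative_compose[OF fst, unfolded fst_conv, OF has_derivative_transition_deriv[OF ij]])
  have "((\<lambda>z. frechet_derivative (transition M i j) (at (fst z)) (snd z)) has_derivative
      (\<lambda>h. transition_deriv2 i j p (fst h) a + transition_deriv M i j p (snd h))) (at (chart M i p, a))"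
    using has_derivative_linear_family[OF eventually_nhds_fst[OF eventually_linear_transition_deriv[OF ij]] 2 snd]
    by simp
  from has_derivative_Pair[OF 1 this] show ?thesis
  proof (rule has_derivative_cong_ev)
    show "\<forall>\<^sub>F z in nhds (chart M i p, a).
       (transition M i j (fst z), frechet_derivative (transition M i j) (at (fst z)) (snd z)) = transition TM i j z"
      using eventually_nhds_fst[OF eventually_overlap[OF ij]]
    proof eventually_elim
      case (elim z)
      then obtain q where q: "q \<in> chart_dom M i" "q \<in> chart_dom M j" "fst z = chart M i q" by auto
      then have "i \<in> charts_at M q" "j \<in> charts_at M q" using ij by (auto simp: charts_at_def)
      then show ?case
        using chart_inv_bundle[of i q "snd z"] q(3)
        by (cases z) (simp add: tangent_bundle_simps coord_vector_nth chart_inv_chart)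
    qed
  qed
qed

end

sublocale smooth_atlas \<subseteq> tangent: differentiable_atlas "tangent_bundle M"
proof
  show "i \<in> chart_index TM \<Longrightarrow> inj_on (chart TM i) (chart_dom TM i)" for i
    using inj_chart_bundle by (simp add: tangent_bundle_simps)
  show "i \<in> chart_index TM \<Longrightarrow> j \<in> chart_index TM \<Longrightarrow>
      open (chart TM i ` (chart_dom TM i \<inter> chart_dom TM j))" for i j
    by (simp add: tangent_bundle_simps(1) bundle_overlap_image open_Times open_overlap)
  show "i \<in> charts_at TM w \<Longrightarrow> j \<in> charts_at TM w \<Longrightarrow>
      transition TM i j differentiable (at (chart TM i w))" for i j w
    using has_derivative_bundle_transition[of i "fst w" j "snd w i"]
    by (auto simp: charts_at_bundle tangent_bundle_simps(3) differentiable_def split: if_splits)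
qed

context smooth_atlas
begin

lemma bundle_tangent_nth:
  assumes w: "v \<in> tangent_space M p" and X: "X \<in> tangent_space TM (p, v)"
    and ij: "i \<in> charts_at M p" "j \<in> charts_at M p"
  shows "X j = (transition_deriv M i j p (fst (X i)),
       transition_deriv2 i j p (fst (X i)) (v i) + transition_deriv M i j p (snd (X i)))"
proof -
  have "X j = transition_deriv TM i j (p, v) (X i)"
    using tangent.tangent_space_nth[OF X, of i j] ij w by (simp add: charts_at_bundle)
  also have "transition_deriv TM i j (p, v) = (\<lambda>h. (transition_deriv M i j p (fst h),
       transition_deriv2 i j p (fst h) (v i) + transition_deriv M i j p (snd h)))"
    using frechet_derivative_eqI[OF has_derivative_bundle_transition[OF ij, of "v i"]]
    by (simp add: tangent_bundle_simps(3))
  finally show ?thesis .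
qed

text \<open>
  The tangent map is computed in some chart around the point; in the coordinates of any chart
  it simply forgets the fibre component.
\<close>

lemma tangent_map_projection:
  assumes w: "v \<in> tangent_space M p" and Y: "Y \<in> tangent_space TM (p, v)"
    and i: "i \<in> charts_at M p"
  shows "tangent_map TM M fst (p, v) Y = coord_vector M i p (fst (Y i))"
proof -
  define k where "k = chart_at TM (p, v)"
  have k: "k \<in> charts_at M p"
    using tangent.chart_at[of "(p, v)"] w i by (auto simp: k_def tangent.points_iff charts_at_bundle)
  have D: "frechet_derivative (chart M j \<circ> fst \<circ> chart_inv TM k) (at (chart TM k (p, v))) (Y k) =
     transition_deriv M k j p (fst (Y k))" if j: "j \<in> charts_at M p" for j
  proof -
    have fst: "(fst has_derivative fst) (at (chart M k p, v k))" by (auto intro!: has_derivative_fst has_derivative_snd has_derivative_ident)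
    have "((\<lambda>z. transition M k j (fst z)) has_derivative (\<lambda>h. transition_deriv M k j p (fst h))) (at (chart M k p, v k))"
      using has_derivative_compose[OF fst, of "transition M k j"] has_derivative_transition[OF k j] by simp
    then have "((chart M j \<circ> fst \<circ> chart_inv TM k) has_derivative (\<lambda>h. transition_deriv M k j p (fst h))) (at (chart M k p, v k))"
    proof (rule has_derivative_cong_ev)
      show "\<forall>\<^sub>F z in nhds (chart M k p, v k). transition M k j (fst z) = (chart M j \<circ> fst \<circ> chart_inv TM k) z"
        using eventually_chart_image_bundle[OF k]
      proof eventually_elim
        case (elim z)
        then obtain q where "k \<in> charts_at M q" "fst z = chart M k q" by blast
        then show ?case using chart_inv_bundle[of k q "snd z"] by (cases z) (simp add: chart_inv_chart)
      qed
    qed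
    then show ?thesis by (simp add: tangent_bundle_simps(3) frechet_derivative_eqI)
  qed
  have "tangent_map TM M fst (p, v) Y = coord_vector M k p (fst (Y k))"
    unfolding tangent_map_def Let_def k_def[symmetric] coord_vector_def using D by (auto simp: fun_eq_iff)
  also have "\<dots> = coord_vector M i p (fst (Y i))"
    using bundle_tangent_nth[OF w Y k i] coord_vector_change[OF k i] by simp
  finally show ?thesis .
qed

end


section \<open>Tensors in coordinates\<close>

context smooth_atlas
begin

lemma rep_eq:
  "i \<in> charts_at M p \<Longrightarrow>
    local_rep2 M \<omega> i (chart M i p) a b = \<omega> p (coord_vector M i p a) (coord_vector M i p b)"
  by (simp add: local_rep2_def chart_inv_chart)

lemma rep_tangent:
  "i \<in> charts_at M p \<Longrightarrow> u \<in> tangent_space M p \<Longrightarrow> v \<in> tangent_space M p \<Longrightarrow>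
    \<omega> p u v = local_rep2 M \<omega> i (chart M i p) (u i) (v i)"
  by (simp add: rep_eq coord_vector_eq)

lemma rep_change:
  "i \<in> charts_at M p \<Longrightarrow> j \<in> charts_at M p \<Longrightarrow>
    local_rep2 M \<omega> j (chart M j p) (transition_deriv M i j p a) (transition_deriv M i j p b) =
    local_rep2 M \<omega> i (chart M i p) a b"
  by (simp add: rep_eq coord_vector_change)

lemma bilinear_rep:
  assumes \<omega>: "smooth_tensor2 M \<omega>" and i: "i \<in> charts_at M p"
  shows "bilinear (local_rep2 M \<omega> i (chart M i p))"
proof -
  have p: "p \<in> points M" using i points_iff by blast
  have 1: "local_rep2 M \<omega> i (chart M i p) (c *\<^sub>R a + b) d =
      c * local_rep2 M \<omega> i (chart M i p) a d + local_rep2 M \<omega> i (chart M i p) b d"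
    and 2: "local_rep2 M \<omega> i (chart M i p) d (c *\<^sub>R a + b) =
      c * local_rep2 M \<omega> i (chart M i p) d a + local_rep2 M \<omega> i (chart M i p) d b" for a b c d
    using \<omega> p coord_vector_tangent[OF i] unfolding smooth_tensor2_def
    by (auto simp: rep_eq[OF i] coord_vector_linear[OF i])
  have lin: "linear f" if "\<And>c a b. f (c *\<^sub>R a + b) = c * f a + f b" for f :: "'e \<Rightarrow> real"
  proof -
    have "f 0 = 0" using that[of 1 0 0] by simp
    then show ?thesis using that[of 1] that[of _ _ 0] by (intro linearI) auto
  qed
  show ?thesis unfolding bilinear_def by (intro conjI allI; rule lin; simp add: 1 2)
qed

definition rep_deriv :: "('i, 'a, 'e) tensor2 \<Rightarrow> 'i \<Rightarrow> 'a \<Rightarrow> 'e \<Rightarrow> 'e \<Rightarrow> 'e \<Rightarrow> real"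
  where "rep_deriv \<omega> i p u a b =
    frechet_derivative (\<lambda>y. local_rep2 M \<omega> i y a b) (at (chart M i p)) u"

lemma has_derivative_rep:
  assumes \<omega>: "smooth_tensor2 M \<omega>" and i: "i \<in> charts_at M p"
  shows "((\<lambda>y. local_rep2 M \<omega> i y a b) has_derivative (\<lambda>u. rep_deriv \<omega> i p u a b)) (at (chart M i p))"
proof -
  have "smooth_on (chart M i ` chart_dom M i) (\<lambda>y. local_rep2 M \<omega> i y a b)"
    using \<omega> charts_atD(1)[OF i] by (simp add: smooth_tensor2_def)
  then have "(\<lambda>y. local_rep2 M \<omega> i y a b) differentiable (at (chart M i p))"
    by (rule smooth_on_differentiable) (use charts_atD(2)[OF i] in simp)
  then show ?thesis unfolding rep_deriv_def frechet_derivative_works by simp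
qed

lemma eventually_bilinear_rep:
  assumes \<omega>: "smooth_tensor2 M \<omega>" and i: "i \<in> charts_at M p"
  shows "\<forall>\<^sub>F y in nhds (chart M i p). bilinear (local_rep2 M \<omega> i y)"
  using eventually_chart_image[OF i] by eventually_elim (metis bilinear_rep[OF \<omega>])

lemma linear_rep_deriv:
  assumes \<omega>: "smooth_tensor2 M \<omega>" and i: "i \<in> charts_at M p"
  shows "linear (\<lambda>u. rep_deriv \<omega> i p u a b)" "linear (\<lambda>a. rep_deriv \<omega> i p u a b)"
    "linear (\<lambda>b. rep_deriv \<omega> i p u a b)"
proof -
  show "linear (\<lambda>u. rep_deriv \<omega> i p u a b)"
    using has_derivative_rep[OF \<omega> i] has_derivative_linear by blast
  show "linear (\<lambda>a. rep_deriv \<omega> i p u a b)"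
    by (rule linear_derivative_of_family[OF _ has_derivative_rep[OF \<omega> i]])
      (use eventually_bilinear_rep[OF \<omega> i] in eventually_elim, simp add: bilinear_def)
  show "linear (\<lambda>b. rep_deriv \<omega> i p u a b)"
    by (rule linear_derivative_of_family[OF _ has_derivative_rep[OF \<omega> i]])
      (use eventually_bilinear_rep[OF \<omega> i] in eventually_elim, simp add: bilinear_def)
qed

text \<open>
  Three factors move: the base point and both arguments. This one rule serves for the
  Lagrangian on the tangent bundle, for changes of charts and for the speed of a curve.
\<close>

lemma has_derivative_rep_along:
  fixes x u w :: "'t::real_normed_vector \<Rightarrow> 'e"
  assumes \<omega>: "smooth_tensor2 M \<omega>" and i: "i \<in> charts_at M p"
    and x: "(x has_derivative x') (at s)" "x s = chart M i p"
    and u: "(u has_derivative u') (at s)" and w: "(w has_derivative w') (at s)"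
  shows "((\<lambda>r. local_rep2 M \<omega> i (x r) (u r) (w r)) has_derivative
    (\<lambda>h. rep_deriv \<omega> i p (x' h) (u s) (w s) + local_rep2 M \<omega> i (chart M i p) (u' h) (w s) +
       local_rep2 M \<omega> i (chart M i p) (u s) (w' h))) (at s)"
proof -
  have "isCont x s" using x(1) has_derivative_continuous by blast
  then have "filterlim x (nhds (chart M i p)) (nhds s)"
    using tendsto_at_iff_tendsto_nhds[of x s] x(2) by (simp add: isCont_def)
  then have ev: "\<forall>\<^sub>F r in nhds s. bilinear (local_rep2 M \<omega> i (x r))"
    by (rule eventually_compose_filterlim[OF eventually_bilinear_rep[OF \<omega> i]])
  have lin: "\<forall>\<^sub>F r in nhds s. linear (\<lambda>a. local_rep2 M \<omega> i (x r) a b)"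
    "\<forall>\<^sub>F r in nhds s. linear (\<lambda>b. local_rep2 M \<omega> i (x r) (u r) b)" for b
    using ev by (auto simp: bilinear_def elim: eventually_mono)
  have 0: "((\<lambda>r. local_rep2 M \<omega> i (x r) a b) has_derivative (\<lambda>h. rep_deriv \<omega> i p (x' h) a b)) (at s)" for a b
    by (rule has_derivative_compose[OF x(1), unfolded x(2), OF has_derivative_rep[OF \<omega> i]])
  have 1: "((\<lambda>r. local_rep2 M \<omega> i (x r) (u r) b) has_derivative
     (\<lambda>h. rep_deriv \<omega> i p (x' h) (u s) b + local_rep2 M \<omega> i (chart M i p) (u' h) b)) (at s)" for b
    using has_derivative_linear_family[of "\<lambda>r a. local_rep2 M \<omega> i (x r) a b", OF lin(1) 0 u]
    by (simp add: x(2))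
  show ?thesis
    using has_derivative_linear_family[of "\<lambda>r b. local_rep2 M \<omega> i (x r) (u r) b", OF lin(2) 1 w]
    by (simp add: x(2))
qed

text \<open>
  The derivative of a tensor is not a tensor: differentiating the transformation law of \<open>\<omega>\<close> also
  hits the chart changes, and produces the two terms with second derivatives.
\<close>

lemma rep_deriv_change:
  assumes \<omega>: "smooth_tensor2 M \<omega>" and ij: "i \<in> charts_at M p" "j \<in> charts_at M p"
  shows "rep_deriv \<omega> i p h a b =
    rep_deriv \<omega> j p (transition_deriv M i j p h) (transition_deriv M i j p a) (transition_deriv M i j p b) +
    local_rep2 M \<omega> j (chart M j p) (transition_deriv2 i j p h a) (transition_deriv M i j p b) +
    local_rep2 M \<omega> j (chart M j p) (transition_deriv M i j p a) (transition_deriv2 i j p h b)"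
proof -
  have "((\<lambda>y. local_rep2 M \<omega> j (transition M i j y) (frechet_derivative (transition M i j) (at y) a)
      (frechet_derivative (transition M i j) (at y) b)) has_derivative
    (\<lambda>h. rep_deriv \<omega> j p (transition_deriv M i j p h) (transition_deriv M i j p a) (transition_deriv M i j p b) +
    local_rep2 M \<omega> j (chart M j p) (transition_deriv2 i j p h a) (transition_deriv M i j p b) +
    local_rep2 M \<omega> j (chart M j p) (transition_deriv M i j p a) (transition_deriv2 i j p h b))) (at (chart M i p))"
    by (rule has_derivative_rep_along[OF \<omega> ij(2) has_derivative_transition[OF ij] _
       has_derivative_transition_deriv[OF ij] has_derivative_transition_deriv[OF ij]])
     (simp add: chart_inv_chart[OF ij(1)])
  then have "((\<lambda>y. local_rep2 M \<omega> i y a b) has_derivative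
    (\<lambda>h. rep_deriv \<omega> j p (transition_deriv M i j p h) (transition_deriv M i j p a) (transition_deriv M i j p b) +
    local_rep2 M \<omega> j (chart M j p) (transition_deriv2 i j p h a) (transition_deriv M i j p b) +
    local_rep2 M \<omega> j (chart M j p) (transition_deriv M i j p a) (transition_deriv2 i j p h b))) (at (chart M i p))"
  proof (rule has_derivative_cong_ev)
    show "\<forall>\<^sub>F y in nhds (chart M i p). local_rep2 M \<omega> j (transition M i j y)
        (frechet_derivative (transition M i j) (at y) a)
        (frechet_derivative (transition M i j) (at y) b) = local_rep2 M \<omega> i y a b"
      using eventually_overlap[OF ij]
    proof eventually_elim
      case (elim y)
      then obtain q where q: "q \<in> chart_dom M i" "q \<in> chart_dom M j" "y = chart M i q" by auto
      then have "i \<in> charts_at M q" "j \<in> charts_at M q" using ij by (auto simp: charts_at_def)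
      then show ?case using rep_change[of i q j \<omega> a b] q(3) by (simp add: chart_inv_chart)
    qed
  qed
  from fun_cong[OF has_derivative_unique[OF has_derivative_rep[OF \<omega> ij(1)] this]] show ?thesis .
qed

end


section \<open>Newton's equation and the dynamical system\<close>

locale mechanics =
  fixes M :: "('i, 'a, 'e::euclidean_space) manifold"
    and m :: "('i, 'a, 'e) tensor2" and V :: "'a \<Rightarrow> real" and \<kappa> :: "('i, 'a, 'e) tensor2"
  assumes mechanical_system: "mechanical_system M m V \<kappa>"

sublocale mechanics \<subseteq> smooth_atlas M
  using mechanical_system by unfold_locales (simp add: mechanical_system_def)

context mechanics
begin

lemma tensors: "smooth_tensor2 M m" "smooth_tensor2 M \<kappa>"
  using mechanical_system
  by (auto simp: mechanical_system_def riemannian_metric_def closed_2form_def smooth_2form_def)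

abbreviation "metric_rep i p \<equiv> local_rep2 M m i (chart M i p)"
abbreviation "gyro_rep i p \<equiv> local_rep2 M \<kappa> i (chart M i p)"

lemma inner_form_metric:
  assumes i: "i \<in> charts_at M p"
  shows "inner_form (metric_rep i p)"
proof -
  have p: "p \<in> points M" using i points_iff by blast
  have m: "riemannian_metric M m" using mechanical_system by (simp add: mechanical_system_def)
  show ?thesis
    unfolding inner_form_def
  proof (intro conjI allI impI)
    show "bilinear (metric_rep i p)" by (rule bilinear_rep[OF tensors(1) i])
    show "metric_rep i p a b = metric_rep i p b a" for a b
      using m p coord_vector_tangent[OF i] by (simp add: riemannian_metric_def rep_eq[OF i])
    fix a :: 'e assume "a \<noteq> 0"
    then have "coord_vector M i p a \<noteq> (\<lambda>_. 0)" using coord_vector_self[OF i, of a] by metis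
    then show "metric_rep i p a a > 0"
      using m p coord_vector_tangent[OF i] by (simp add: riemannian_metric_def rep_eq[OF i])
  qed
qed

lemma metric_sym: "i \<in> charts_at M p \<Longrightarrow> metric_rep i p a b = metric_rep i p b a"
  using inner_form_metric inner_form_def by blast

lemma rep_deriv_metric_sym:
  assumes i: "i \<in> charts_at M p"
  shows "rep_deriv m i p u a b = rep_deriv m i p u b a"
proof -
  have "\<forall>\<^sub>F y in nhds (chart M i p). local_rep2 M m i y a b = local_rep2 M m i y b a"
    using eventually_chart_image[OF i] by eventually_elim (metis metric_sym)
  from frechet_derivative_cong_ev[OF this] show ?thesis by (simp add: rep_deriv_def)
qed

definition potential_deriv :: "'i \<Rightarrow> 'a \<Rightarrow> 'e \<Rightarrow> real"
  where "potential_deriv i p = frechet_derivative (V \<circ> chart_inv M i) (at (chart M i p))"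

lemma has_derivative_potential:
  assumes i: "i \<in> charts_at M p"
  shows "((V \<circ> chart_inv M i) has_derivative potential_deriv i p) (at (chart M i p))"
proof -
  have "smooth_on (chart M i ` chart_dom M i) (V \<circ> chart_inv M i)"
    using mechanical_system charts_atD(1)[OF i] by (simp add: mechanical_system_def smooth_function_def)
  then have "(V \<circ> chart_inv M i) differentiable (at (chart M i p))"
    by (rule smooth_on_differentiable) (use charts_atD(2)[OF i] in simp)
  then show ?thesis unfolding potential_deriv_def frechet_derivative_works by simp
qed

lemma linear_potential_deriv: "i \<in> charts_at M p \<Longrightarrow> linear (potential_deriv i p)"
  using has_derivative_potential has_derivative_linear by blast

lemma potential_deriv_change:
  assumes ij: "i \<in> charts_at M p" "j \<in> charts_at M p"
  shows "potential_deriv j p (transition_deriv M i j p a) = potential_deriv i p a"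
proof -
  have "((V \<circ> chart_inv M j) has_derivative potential_deriv j p) (at (transition M i j (chart M i p)))"
    using has_derivative_potential[OF ij(2)] by (simp add: chart_inv_chart[OF ij(1)])
  from has_derivative_compose[OF has_derivative_transition[OF ij] this]
  have "((V \<circ> chart_inv M i) has_derivative (\<lambda>a. potential_deriv j p (transition_deriv M i j p a))) (at (chart M i p))"
  proof (rule has_derivative_cong_ev)
    show "\<forall>\<^sub>F y in nhds (chart M i p). (V \<circ> chart_inv M j) (transition M i j y) = (V \<circ> chart_inv M i) y"
      using eventually_overlap[OF ij]
    proof eventually_elim
      case (elim y)
      then obtain q where q: "q \<in> chart_dom M i" "q \<in> chart_dom M j" "y = chart M i q" by auto
      then have "i \<in> charts_at M q" "j \<in> charts_at M q" using ij by (auto simp: charts_at_def)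
      then show ?case using q(3) by (simp add: chart_inv_chart)
    qed
  qed
  then show ?thesis using has_derivative_potential[OF ij(1)] has_derivative_unique by metis
qed

text \<open>
  The equation \<open>\<nabla>\<^bsub>v\<^esub> v = - grad V - (i\<^bsub>v\<^esub> \<kappa>)\<^sup>#\<close> for the metric \<open>m\<close>, paired with \<open>\<eta>\<close>, where \<open>a\<close> is the
  coordinate acceleration. The terms with \<open>rep_deriv\<close> are the Christoffel symbol of \<open>m\<close> by the
  Koszul formula.
\<close>

definition newton :: "'i \<Rightarrow> 'a \<Rightarrow> 'e \<Rightarrow> 'e \<Rightarrow> bool"
  where "newton i p v a \<longleftrightarrow> (\<forall>\<eta>. metric_rep i p a \<eta> + rep_deriv m i p v v \<eta> - rep_deriv m i p \<eta> v v / 2 +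
    gyro_rep i p v \<eta> + potential_deriv i p \<eta> = 0)"

lemma newton_solvable:
  assumes i: "i \<in> charts_at M p"
  shows "\<exists>a. newton i p v a"
proof -
  have lin: "linear (\<lambda>\<eta>. - (rep_deriv m i p v v \<eta> - (1/2) *\<^sub>R rep_deriv m i p \<eta> v v +
    gyro_rep i p v \<eta> + potential_deriv i p \<eta>))"
    using bilinear_rep[OF tensors(2) i]
    by (intro linear_compose_neg linear_compose_add linear_compose_sub linear_compose_scale_right
        linear_rep_deriv tensors i linear_potential_deriv) (simp add: bilinear_def)
  obtain a where "\<And>\<eta>. metric_rep i p a \<eta> = - (rep_deriv m i p v v \<eta> - (1/2) *\<^sub>R rep_deriv m i p \<eta> v v +
    gyro_rep i p v \<eta> + potential_deriv i p \<eta>)"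
    using inner_form_riesz[OF inner_form_metric[OF i] lin] by blast
  then have "newton i p v a" unfolding newton_def by simp
  then show ?thesis by blast
qed

lemma newton_unique:
  assumes i: "i \<in> charts_at M p" and "newton i p v a" "newton i p v b"
  shows "a = b"
proof (rule inner_form_ext[OF inner_form_metric[OF i]])
  show "metric_rep i p a \<eta> = metric_rep i p b \<eta>" for \<eta>
    using assms(2,3)[unfolded newton_def, THEN spec, of \<eta>] by linarith
qed

text \<open>
  The inhomogeneous terms of the acceleration and of the derivatives of the metric cancel. The
  covector part leaves \<open>\<langle>v, D\<^sup>2\<phi>(v, \<eta>) - D\<^sup>2\<phi>(\<eta>, v)\<rangle>\<close>, which vanishes because second derivatives are
  symmetric.
\<close>

lemma newton_change:
  assumes ij: "i \<in> charts_at M p" "j \<in> charts_at M p" and N: "newton i p v a"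
  shows "newton j p (transition_deriv M i j p v)
    (transition_deriv2 i j p v v + transition_deriv M i j p a)"
  unfolding newton_def
proof
  fix \<eta>'
  \<comment> \<open>every vector of the chart \<open>j\<close> comes from one of the chart \<open>i\<close>\<close>
  define \<eta> where "\<eta> = transition_deriv M j i p \<eta>'"
  have \<eta>': "\<eta>' = transition_deriv M i j p \<eta>"
    by (simp add: \<eta>_def transition_deriv_trans transition_deriv_refl ij)
  have bil: "bilinear (metric_rep j p)" by (rule bilinear_rep[OF tensors(1) ij(2)])
  show "metric_rep j p (transition_deriv2 i j p v v + transition_deriv M i j p a) \<eta>' +
       rep_deriv m j p (transition_deriv M i j p v) (transition_deriv M i j p v) \<eta>' -
       rep_deriv m j p \<eta>' (transition_deriv M i j p v) (transition_deriv M i j p v) / 2 +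
       gyro_rep j p (transition_deriv M i j p v) \<eta>' + potential_deriv j p \<eta>' = 0"
    using N[unfolded newton_def, THEN spec, of \<eta>]
      rep_deriv_change[OF tensors(1) ij, of v v \<eta>] rep_deriv_change[OF tensors(1) ij, of \<eta> v v]
      transition_deriv2_sym[OF ij, of \<eta> v]
      metric_sym[OF ij(2), of "transition_deriv2 i j p v \<eta>" "transition_deriv M i j p v"]
    unfolding \<eta>'
    by (simp add: add_divide_distrib bilinear_ladd[OF bil] rep_change[OF ij] potential_deriv_change[OF ij])
qed

lemma lagrange_1form_rep:
  assumes i: "i \<in> charts_at M p"
  shows "local_rep1 TM (lagrange_1form M m) i (chart M i p, a) \<xi> = metric_rep i p a (fst \<xi>)"
proof -
  define Y where "Y = coord_vector TM i (p, coord_vector M i p a) \<xi>"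
  have a: "coord_vector M i p a \<in> tangent_space M p" by (rule coord_vector_tangent[OF i])
  then have i': "i \<in> charts_at TM (p, coord_vector M i p a)" using i by (simp add: charts_at_bundle)
  have Y: "Y \<in> tangent_space TM (p, coord_vector M i p a)" "Y i = \<xi>"
    unfolding Y_def using tangent.coord_vector_tangent[OF i'] tangent.coord_vector_self[OF i'] by auto
  show ?thesis
    using tangent_map_projection[OF a Y(1) i]
    by (simp add: local_rep1_def Let_def chart_inv_bundle[OF i] lagrange_1form_def Y_def[symmetric] Y(2) rep_eq[OF i])
qed

text \<open>
  The pointwise notions on the tangent bundle are computed in the chart chosen at \<open>(p, v)\<close>, which is
  the chart chosen at \<open>p\<close>; this is the chart \<open>i\<close> below.
\<close>

context
  fixes p v i
  assumes v: "v \<in> tangent_space M p" and i: "i \<in> charts_at M p" and i_def: "i = chart_at M p"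
begin

lemma chart_at_bundle: "chart_at TM (p, v) = i"
  using v by (simp add: chart_at_def charts_at_bundle i_def)

lemma lagrange_1form_derivative:
  "frechet_derivative (\<lambda>z. local_rep1 TM (lagrange_1form M m) i z \<xi>) (at (chart TM i (p, v))) h =
    rep_deriv m i p (fst h) (v i) (fst \<xi>) + metric_rep i p (snd h) (fst \<xi>)"
proof -
  have "((\<lambda>z. local_rep2 M m i (fst z) (snd z) (fst \<xi>)) has_derivative
     (\<lambda>h. rep_deriv m i p (fst h) (snd (chart M i p, v i)) (fst \<xi>) + metric_rep i p (snd h) (fst \<xi>) +
       metric_rep i p (snd (chart M i p, v i)) 0)) (at (chart M i p, v i))"
    by (rule has_derivative_rep_along[OF tensors(1) i])
      (auto intro!: has_derivative_fst has_derivative_snd has_derivative_ident)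
  then have "((\<lambda>z. local_rep1 TM (lagrange_1form M m) i z \<xi>) has_derivative
    (\<lambda>h. rep_deriv m i p (fst h) (snd (chart M i p, v i)) (fst \<xi>) + metric_rep i p (snd h) (fst \<xi>) +
       metric_rep i p (snd (chart M i p, v i)) 0)) (at (chart M i p, v i))"
  proof (rule has_derivative_cong_ev)
    show "\<forall>\<^sub>F z in nhds (chart M i p, v i).
        local_rep2 M m i (fst z) (snd z) (fst \<xi>) = local_rep1 TM (lagrange_1form M m) i z \<xi>"
      using eventually_chart_image_bundle[OF i]
    proof eventually_elim
      case (elim z)
      then obtain q where "i \<in> charts_at M q" "fst z = chart M i q" by blast
      then show ?case using lagrange_1form_rep[of i q "snd z" \<xi>] by (cases z) simp
    qed
  qed
  from frechet_derivative_eqI[OF this] show ?thesis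
    by (simp add: tangent_bundle_simps(3) bilinear_rzero[OF bilinear_rep[OF tensors(1) i]])
qed

lemma energy_derivative:
  assumes "Y \<in> tangent_space TM (p, v)"
  shows "ext_deriv0 TM (\<lambda>w. kinetic_energy m w + V (fst w)) (p, v) Y =
    rep_deriv m i p (fst (Y i)) (v i) (v i) / 2 + metric_rep i p (snd (Y i)) (v i) + potential_deriv i p (fst (Y i))"
proof -
  have fst: "(fst has_derivative fst) (at (chart M i p, v i))"
    by (auto intro!: has_derivative_fst has_derivative_ident)
  have 1: "((\<lambda>z. local_rep2 M m i (fst z) (snd z) (snd z)) has_derivative
     (\<lambda>h. rep_deriv m i p (fst h) (snd (chart M i p, v i)) (snd (chart M i p, v i)) +
       metric_rep i p (snd h) (snd (chart M i p, v i)) +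
       metric_rep i p (snd (chart M i p, v i)) (snd h))) (at (chart M i p, v i))"
    by (rule has_derivative_rep_along[OF tensors(1) i])
      (auto intro!: has_derivative_fst has_derivative_snd has_derivative_ident)
  have 2: "((\<lambda>z. (V \<circ> chart_inv M i) (fst z)) has_derivative (\<lambda>h. potential_deriv i p (fst h))) (at (chart M i p, v i))"
    by (rule has_derivative_compose[OF fst, unfolded fst_conv, OF has_derivative_potential[OF i]])
  have "((\<lambda>z. (1/2) *\<^sub>R local_rep2 M m i (fst z) (snd z) (snd z) + (V \<circ> chart_inv M i) (fst z)) has_derivative
    (\<lambda>h. (1/2) *\<^sub>R (rep_deriv m i p (fst h) (snd (chart M i p, v i)) (snd (chart M i p, v i)) +
       metric_rep i p (snd h) (snd (chart M i p, v i)) +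
       metric_rep i p (snd (chart M i p, v i)) (snd h)) + potential_deriv i p (fst h))) (at (chart M i p, v i))"
    by (rule has_derivative_add[OF has_derivative_scaleR_right[OF 1] 2])
  then have "(((\<lambda>w. kinetic_energy m w + V (fst w)) \<circ> chart_inv TM i) has_derivative
    (\<lambda>h. (1/2) *\<^sub>R (rep_deriv m i p (fst h) (snd (chart M i p, v i)) (snd (chart M i p, v i)) +
       metric_rep i p (snd h) (snd (chart M i p, v i)) +
       metric_rep i p (snd (chart M i p, v i)) (snd h)) + potential_deriv i p (fst h))) (at (chart M i p, v i))"
  proof (rule has_derivative_cong_ev)
    show "\<forall>\<^sub>F z in nhds (chart M i p, v i). (1/2) *\<^sub>R local_rep2 M m i (fst z) (snd z) (snd z) +
       (V \<circ> chart_inv M i) (fst z) = ((\<lambda>w. kinetic_energy m w + V (fst w)) \<circ> chart_inv TM i) z"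
      using eventually_chart_image_bundle[OF i]
    proof eventually_elim
      case (elim z)
      then obtain q where "i \<in> charts_at M q" "fst z = chart M i q" by blast
      then show ?case using chart_inv_bundle[of i q "snd z"]
        by (cases z) (simp add: kinetic_energy_def rep_eq chart_inv_chart)
    qed
  qed
  from frechet_derivative_eqI[OF this] show ?thesis
    by (simp add: ext_deriv0_def Let_def chart_at_bundle tangent_bundle_simps(3) metric_sym[OF i, of "v i"])
qed

text \<open>
  In coordinates, with \<open>X = (\<xi>, a)\<close> and \<open>Y = (\<eta>, b)\<close>, the equation reads
  \<open>Dm[\<xi>](v, \<eta>) + m(a, \<eta>) - Dm[\<eta>](v, \<xi>) - m(b, \<xi>) + \<kappa>(\<xi>, \<eta>) = - Dm[\<eta>](v, v) / 2 - m(b, v) - DV[\<eta>]\<close>.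
  The terms in \<open>b\<close> force \<open>\<xi> = v\<close>, and what remains is Newton's equation.
\<close>

lemma dynamics_iff_newton:
  assumes X: "X \<in> tangent_space TM (p, v)"
  shows "(\<forall>Y\<in>tangent_space TM (p, v).
       lagrange_2form M m (p, v) X Y + pullback2 TM M fst \<kappa> (p, v) X Y =
       - ext_deriv0 TM (\<lambda>w. kinetic_energy m w + V (fst w)) (p, v) Y) \<longleftrightarrow>
    fst (X i) = v i \<and> newton i p (v i) (snd (X i))" (is "?L \<longleftrightarrow> ?R")
proof -
  have i': "i \<in> charts_at TM (p, v)" using i v by (simp add: charts_at_bundle)
  \<comment> \<open>every pair of coordinate vectors comes from a tangent vector of the bundle\<close>
  have all: "(\<forall>Y\<in>tangent_space TM (p, v). P (Y i)) \<longleftrightarrow> (\<forall>\<eta> b. P (\<eta>, b))" for P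
  proof safe
    fix \<eta> b assume *: "\<forall>Y\<in>tangent_space TM (p, v). P (Y i)"
    show "P (\<eta>, b)"
      using bspec[OF *, OF tangent.coord_vector_tangent[OF i', of "(\<eta>, b)"]]
      by (simp add: tangent.coord_vector_self[OF i'])
  next
    fix Y assume *: "\<forall>\<eta> b. P (\<eta>, b)"
    show "P (Y i)" using * by (cases "Y i") simp
  qed
  let ?E = "\<lambda>Yi. rep_deriv m i p (fst (X i)) (v i) (fst Yi) + metric_rep i p (snd (X i)) (fst Yi) -
        (rep_deriv m i p (fst Yi) (v i) (fst (X i)) + metric_rep i p (snd Yi) (fst (X i))) +
        gyro_rep i p (fst (X i)) (fst Yi) =
       - (rep_deriv m i p (fst Yi) (v i) (v i) / 2 + metric_rep i p (snd Yi) (v i) + potential_deriv i p (fst Yi))"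
  have zero: "rep_deriv m i p 0 a b = 0" "rep_deriv m i p a b 0 = 0" "metric_rep i p 0 a = 0" "metric_rep i p a 0 = 0"
    "gyro_rep i p a 0 = 0" "potential_deriv i p 0 = 0" for a b
    using linear_0[OF linear_rep_deriv(1)[OF tensors(1) i]] linear_0[OF linear_rep_deriv(3)[OF tensors(1) i]]
      bilinear_lzero[OF bilinear_rep[OF tensors(1) i]] bilinear_rzero[OF bilinear_rep[OF tensors(1) i]]
      bilinear_rzero[OF bilinear_rep[OF tensors(2) i]] linear_0[OF linear_potential_deriv[OF i]] by auto
  have "?L \<longleftrightarrow> (\<forall>Y\<in>tangent_space TM (p, v). ?E (Y i))"
  proof (rule ball_cong[OF refl])
    fix Y assume Y: "Y \<in> tangent_space TM (p, v)"
    have "pullback2 TM M fst \<kappa> (p, v) X Y = gyro_rep i p (fst (X i)) (fst (Y i))"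
      by (simp add: pullback2_def tangent_map_projection[OF v _ i] X Y rep_eq[OF i])
    moreover have "lagrange_2form M m (p, v) X Y =
       rep_deriv m i p (fst (X i)) (v i) (fst (Y i)) + metric_rep i p (snd (X i)) (fst (Y i)) -
        (rep_deriv m i p (fst (Y i)) (v i) (fst (X i)) + metric_rep i p (snd (Y i)) (fst (X i)))"
      by (simp add: lagrange_2form_def ext_deriv1_def Let_def chart_at_bundle lagrange_1form_derivative)
    ultimately show "(lagrange_2form M m (p, v) X Y + pullback2 TM M fst \<kappa> (p, v) X Y =
       - ext_deriv0 TM (\<lambda>w. kinetic_energy m w + V (fst w)) (p, v) Y) = ?E (Y i)"
      by (simp add: energy_derivative[OF Y])
  qed
  also have "\<dots> \<longleftrightarrow> (\<forall>\<eta> b. ?E (\<eta>, b))" by (rule all)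
  also have "\<dots> \<longleftrightarrow> ?R"
  proof
    assume E: "\<forall>\<eta> b. ?E (\<eta>, b)"
    have "metric_rep i p (fst (X i)) b = metric_rep i p (v i) b" for b
      using E[THEN spec, THEN spec, of 0 b] by (simp add: zero metric_sym[OF i, of b])
    then have eq: "fst (X i) = v i" by (rule inner_form_ext[OF inner_form_metric[OF i]])
    moreover have "newton i p (v i) (snd (X i))"
      unfolding newton_def
    proof
      fix \<eta>
      show "metric_rep i p (snd (X i)) \<eta> + rep_deriv m i p (v i) (v i) \<eta> - rep_deriv m i p \<eta> (v i) (v i) / 2 +
         gyro_rep i p (v i) \<eta> + potential_deriv i p \<eta> = 0"
        using E[THEN spec, THEN spec, of \<eta> 0] by (simp add: zero eq)
    qed
    ultimately show ?R ..
  next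
    assume R: ?R
    show "\<forall>\<eta> b. ?E (\<eta>, b)"
    proof (intro allI)
      fix \<eta> b
      show "?E (\<eta>, b)" using R[THEN conjunct2, unfolded newton_def, THEN spec, of \<eta>] R by simp
    qed
  qed
  finally show ?thesis .
qed

text \<open>
  Newton's equation has exactly one solution \<open>a\<close> since the metric is nondegenerate, so the
  definite description of the vector field denotes.
\<close>

lemma dynamical_system_iff:
  "X = dynamical_system M m V \<kappa> (p, v) \<longleftrightarrow>
    X \<in> tangent_space TM (p, v) \<and> fst (X i) = v i \<and> newton i p (v i) (snd (X i))"
proof -
  have i': "i \<in> charts_at TM (p, v)" using i v by (simp add: charts_at_bundle)
  let ?Q = "\<lambda>X. X \<in> tangent_space TM (p, v) \<and> fst (X i) = v i \<and> newton i p (v i) (snd (X i))"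
  obtain a where a: "newton i p (v i) a" using newton_solvable[OF i] by blast
  have ex: "?Q (coord_vector TM i (p, v) (v i, a))"
    using tangent.coord_vector_tangent[OF i'] tangent.coord_vector_self[OF i'] a by simp
  have un: "X = Y" if "?Q X" "?Q Y" for X Y
  proof -
    have "snd (X i) = snd (Y i)" using that newton_unique[OF i] by blast
    then have "X i = Y i" using that by (simp add: prod_eq_iff)
    then show ?thesis using that tangent.tangent_space_eqI[OF _ _ i'] by blast
  qed
  have "dynamical_system M m V \<kappa> (p, v) = (THE X. ?Q X)"
    unfolding dynamical_system_def
    by (rule arg_cong[where f = The], rule ext) (use dynamics_iff_newton in blast)
  moreover have "?Q (THE X. ?Q X)" by (rule theI[of ?Q, OF ex]) (use un ex in blast)
  ultimately have Q: "?Q (dynamical_system M m V \<kappa> (p, v))" by simp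
  show ?thesis using un[OF _ Q] Q by blast
qed

end

end


context mechanics
begin

text \<open>
  An integral curve of the dynamical system satisfies Newton's equation in the chosen chart
  by \<open>dynamical_system_iff\<close>; \<open>newton_change\<close> gives it in every chart.
\<close>

lemma motion_velocity:
  assumes w: "has_velocity TM w t (dynamical_system M m V \<kappa> (w t))"
  shows "has_velocity M (\<lambda>s. fst (w s)) t (snd (w t))"
    and "i \<in> charts_at M (fst (w t)) \<Longrightarrow>
      \<exists>a. ((\<lambda>s. snd (w s) i) has_vector_derivative a) (at t) \<and> newton i (fst (w t)) (snd (w t) i) a"
proof -
  define p v X where "p = fst (w t)" and "v = snd (w t)" and "X = dynamical_system M m V \<kappa> (w t)"
  have wt: "w t = (p, v)" by (simp add: p_def v_def)
  obtain i0 where "i0 \<in> charts_at TM (w t)" using tangent.has_velocityD(1)[OF w] tangent.points_iff by blast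
  then have v: "v \<in> tangent_space M p" and p: "p \<in> points M"
    by (auto simp: charts_at_bundle p_def v_def points_iff split: if_splits)
  define k where "k = chart_at M p"
  have k: "k \<in> charts_at M p" using chart_at[OF p] by (simp add: k_def)
  have X: "X \<in> tangent_space TM (p, v)" "fst (X k) = v k" "newton k p (v k) (snd (X k))"
    using dynamical_system_iff[OF v k k_def, of X] by (auto simp: X_def wt)
  have ct: "charts_at TM (w t) = charts_at M p" using v by (simp add: charts_at_bundle wt)
  have nth: "X i = (v i, transition_deriv2 k i p (v k) (v k) + transition_deriv M k i p (snd (X k)))"
    if i: "i \<in> charts_at M p" for i
    using bundle_tangent_nth[OF v X(1) k i] X(2) tangent_space_nth[OF v k i] by simp
  have d: "((\<lambda>s. (chart M i (fst (w s)), snd (w s) i)) has_vector_derivative X i) (at t)"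
    if i: "i \<in> charts_at M p" for i
    using tangent.has_velocityD(4)[OF w, of i] i by (simp add: ct tangent_bundle_simps(3) X_def)
  have d1: "((\<lambda>s. chart M i (fst (w s))) has_vector_derivative v i) (at t)" if i: "i \<in> charts_at M p" for i
    using has_derivative_fst[OF d[OF i, unfolded has_vector_derivative_def]] nth[OF i]
    by (simp add: has_vector_derivative_def)
  have "\<forall>\<^sub>F s in nhds t. k \<in> charts_at TM (w s)" using tangent.has_velocityD(3)[OF w] k ct by simp
  then have "\<forall>\<^sub>F s in nhds t. fst (w s) \<in> chart_dom M k"
    by eventually_elim (simp add: charts_at_def tangent_bundle_simps case_prod_unfold)
  then have "has_velocity M (\<lambda>s. fst (w s)) t (coord_vector M k p (v k))"
    unfolding p_def by (intro has_velocity_from_chart) (use k d1[OF k] in \<open>simp_all add: p_def\<close>)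
  then show "has_velocity M (\<lambda>s. fst (w s)) t (snd (w t))"
    using coord_vector_eq[OF v k] by (simp add: v_def)
  assume "i \<in> charts_at M (fst (w t))"
  then have i: "i \<in> charts_at M p" by (simp add: p_def)
  have "((\<lambda>s. snd (w s) i) has_vector_derivative snd (X i)) (at t)"
    using has_derivative_snd[OF d[OF i, unfolded has_vector_derivative_def]]
    by (simp add: has_vector_derivative_def)
  moreover have "newton i p (v i) (snd (X i))"
    using newton_change[OF k i X(3)] by (simp add: nth[OF i] tangent_space_nth[OF v k i])
  ultimately show "\<exists>a. ((\<lambda>s. snd (w s) i) has_vector_derivative a) (at t) \<and> newton i (fst (w t)) (snd (w t) i) a"
    by (auto simp: p_def v_def)
qed

end


section \<open>The Jacobi metric\<close>

locale jacobi = mechanics M m V \<kappa>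
  for M :: "('i, 'a, 'e::euclidean_space) manifold"
    and m :: "('i, 'a, 'e) tensor2" and V :: "'a \<Rightarrow> real" and \<kappa> :: "('i, 'a, 'e) tensor2" +
  fixes h :: real
begin

abbreviation "M\<^sub>h \<equiv> sublevel_manifold M V h"
abbreviation "m\<^sub>h \<equiv> jacobi_metric m V h"
abbreviation "conf_factor p \<equiv> 2 * (h - V p)"

lemma sublevel_simps:
  "chart M\<^sub>h = chart M" "chart_index M\<^sub>h = chart_index M"
  "chart_dom M\<^sub>h i = chart_dom M i \<inter> {x \<in> points M. V x < h}"
  by (auto simp: sublevel_manifold_def open_submanifold_def)

lemma points_sublevel: "p \<in> points M\<^sub>h \<longleftrightarrow> p \<in> points M \<and> V p < h"
  by (auto simp: points_def sublevel_simps)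

lemma charts_at_sublevel: "p \<in> points M\<^sub>h \<Longrightarrow> charts_at M\<^sub>h p = charts_at M p"
  by (auto simp: points_sublevel charts_at_def sublevel_simps)

lemma chart_inv_sublevel:
  "p \<in> points M\<^sub>h \<Longrightarrow> i \<in> charts_at M p \<Longrightarrow> chart_inv M\<^sub>h i (chart M i p) = p"
  unfolding chart_inv_def sublevel_simps
  by (rule inv_into_f_f) (auto simp: points_sublevel charts_at_def intro: inj_on_subset[OF inj_chart])

text \<open>
  The sublevel set is open because \<open>V\<close> is continuous in every chart. Therefore all notions defined
  by germs agree for \<open>M\<^sub>h\<close> and \<open>M\<close> at its points.
\<close>

lemma eventually_sublevel:
  assumes p: "p \<in> points M\<^sub>h" and i: "i \<in> charts_at M p"
  shows "\<forall>\<^sub>F y in nhds (chart M i p). \<exists>q. q \<in> points M\<^sub>h \<and> i \<in> charts_at M q \<and> y = chart M i q"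
proof -
  have "isCont (V \<circ> chart_inv M i) (chart M i p)"
    using has_derivative_potential[OF i] has_derivative_continuous by blast
  then have "filterlim (V \<circ> chart_inv M i) (nhds (V p)) (nhds (chart M i p))"
    using tendsto_at_iff_tendsto_nhds[of "V \<circ> chart_inv M i" "chart M i p"] chart_inv_chart[OF i]
    by (simp add: isCont_def)
  moreover have "\<forall>\<^sub>F r in nhds (V p). r < h"
    using p eventually_nhds_in_open[of "{..<h}" "V p"] by (simp add: points_sublevel)
  ultimately have "\<forall>\<^sub>F y in nhds (chart M i p). V (chart_inv M i y) < h"
    using eventually_compose_filterlim by fastforce
  then show ?thesis
    using eventually_chart_image[OF i]
  proof eventually_elim
    case (elim y)
    then show ?case using points_iff points_sublevel by (metis (no_types))
  qed
qed

lemma transition_deriv_sublevel: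
  assumes p: "p \<in> points M\<^sub>h" and ij: "i \<in> charts_at M p" "j \<in> charts_at M p"
  shows "transition_deriv M\<^sub>h i j p = transition_deriv M i j p"
  unfolding sublevel_simps
  by (rule frechet_derivative_cong_ev)
    (use eventually_sublevel[OF p ij(1)] in eventually_elim, use chart_inv_sublevel chart_inv_chart in auto)

lemma tangent_space_sublevel: "p \<in> points M\<^sub>h \<Longrightarrow> tangent_space M\<^sub>h p = tangent_space M p"
  unfolding tangent_space_def by (simp add: charts_at_sublevel transition_deriv_sublevel cong: ball_cong)

lemma coord_vector_sublevel:
  "p \<in> points M\<^sub>h \<Longrightarrow> i \<in> charts_at M p \<Longrightarrow> coord_vector M\<^sub>h i p = coord_vector M i p"
  unfolding coord_vector_def by (auto simp add: charts_at_sublevel transition_deriv_sublevel fun_eq_iff)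

lemma has_velocity_sublevel:
  assumes "c t \<in> points M\<^sub>h"
  shows "has_velocity M\<^sub>h c t \<xi> \<longleftrightarrow> has_velocity M c t \<xi>"
proof
  assume "has_velocity M\<^sub>h c t \<xi>"
  then show "has_velocity M c t \<xi>"
    unfolding has_velocity_def
    by (auto simp: charts_at_sublevel[OF assms] tangent_space_sublevel[OF assms] sublevel_simps points_sublevel
        elim: eventually_mono)
next
  assume v: "has_velocity M c t \<xi>"
  have "\<forall>\<^sub>F s in nhds t. c s \<in> chart_dom M\<^sub>h i" if i: "i \<in> charts_at M (c t)" for i
  proof -
    have "filterlim (\<lambda>s. chart M i (c s)) (nhds (chart M i (c t))) (nhds t)"
      using tendsto_at_iff_tendsto_nhds[of "\<lambda>s. chart M i (c s)" t] has_velocityD(5)[OF v i]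
      by (simp add: isCont_def)
    from eventually_compose_filterlim[OF eventually_sublevel[OF assms i] this] has_velocityD(3)[OF v i]
    show ?thesis
    proof eventually_elim
      case (elim s)
      then obtain q where "q \<in> points M\<^sub>h" "i \<in> charts_at M q" "chart M i (c s) = chart M i q" by blast
      then have "c s = q" using elim(2) chart_inv_chart by metis
      then show ?case using \<open>q \<in> _\<close> elim(2) by (auto simp: sublevel_simps points_sublevel charts_at_def)
    qed
  qed
  then show "has_velocity M\<^sub>h c t \<xi>"
    using v assms unfolding has_velocity_def
    by (auto simp: charts_at_sublevel[OF assms] tangent_space_sublevel[OF assms] sublevel_simps(1))
qed

lemma velocity_sublevel: "c t \<in> points M\<^sub>h \<Longrightarrow> velocity M\<^sub>h c t = velocity M c t"
  by (simp add: velocity_def has_velocity_sublevel)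

lemma rep_sublevel:
  "p \<in> points M\<^sub>h \<Longrightarrow> i \<in> charts_at M p \<Longrightarrow>
    local_rep2 M\<^sub>h m\<^sub>h i (chart M i p) a b = conf_factor p * metric_rep i p a b"
  by (simp add: local_rep2_def chart_inv_sublevel coord_vector_sublevel chart_inv_chart jacobi_metric_def)

lemma inner_form_sublevel:
  assumes p: "p \<in> points M\<^sub>h" and i: "i \<in> charts_at M p"
  shows "inner_form (local_rep2 M\<^sub>h m\<^sub>h i (chart M i p))"
proof -
  have eq: "local_rep2 M\<^sub>h m\<^sub>h i (chart M i p) = (\<lambda>a b. conf_factor p * metric_rep i p a b)"
    using rep_sublevel[OF p i] by (intro ext)
  have lin: "linear (\<lambda>a. conf_factor p * f a)" if "linear f" for f :: "'e \<Rightarrow> real"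
    using linear_compose_scale_right[OF that, of "conf_factor p"] by simp
  have "conf_factor p > 0" using p by (simp add: points_sublevel)
  then show ?thesis
    using inner_form_metric[OF i] unfolding eq inner_form_def bilinear_def by (auto intro!: lin simp del: distrib_left_numeral right_diff_distrib_numeral)
qed

text \<open>
  The derivative of the coordinate representation of \<open>f m\<close>, by the Leibniz rule with \<open>df = - 2 dV\<close>.
\<close>

definition jacobi_deriv :: "'i \<Rightarrow> 'a \<Rightarrow> 'e \<Rightarrow> 'e \<Rightarrow> 'e \<Rightarrow> real"
  where "jacobi_deriv i p u a b = conf_factor p * rep_deriv m i p u a b - 2 * potential_deriv i p u * metric_rep i p a b"

lemma has_derivative_rep_sublevel:
  assumes p: "p \<in> points M\<^sub>h" and i: "i \<in> charts_at M p"
  shows "((\<lambda>y. local_rep2 M\<^sub>h m\<^sub>h i y a b) has_derivative (\<lambda>u. jacobi_deriv i p u a b)) (at (chart M i p))"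
proof -
  have "((\<lambda>y. (2 * (h - (V \<circ> chart_inv M i) y)) * local_rep2 M m i y a b) has_derivative
    (\<lambda>u. (2 * (h - (V \<circ> chart_inv M i) (chart M i p))) * rep_deriv m i p u a b +
      2 * (0 - potential_deriv i p u) * metric_rep i p a b)) (at (chart M i p))"
    by (intro has_derivative_mult has_derivative_rep tensors i has_derivative_mult_right has_derivative_diff
       has_derivative_const has_derivative_potential)
  then have "((\<lambda>y. local_rep2 M\<^sub>h m\<^sub>h i y a b) has_derivative
    (\<lambda>u. (2 * (h - (V \<circ> chart_inv M i) (chart M i p))) * rep_deriv m i p u a b +
      2 * (0 - potential_deriv i p u) * metric_rep i p a b)) (at (chart M i p))"
  proof (rule has_derivative_cong_ev)
    show "\<forall>\<^sub>F y in nhds (chart M i p). (2 * (h - (V \<circ> chart_inv M i) y)) * local_rep2 M m i y a b =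
        local_rep2 M\<^sub>h m\<^sub>h i y a b"
      using eventually_sublevel[OF p i]
      by eventually_elim (auto simp: chart_inv_chart rep_sublevel)
  qed
  then show ?thesis
    by (rule has_derivative_eq_rhs) (simp add: jacobi_deriv_def chart_inv_chart[OF i] fun_eq_iff)
qed

lemma levi_civita_sublevel:
  assumes p: "p \<in> points M\<^sub>h" and i: "i \<in> charts_at M p"
  shows "2 * (conf_factor p * metric_rep i p (levi_civita M\<^sub>h m\<^sub>h i (chart M i p) a b) c) =
    jacobi_deriv i p a b c + jacobi_deriv i p b a c - jacobi_deriv i p c a b"
proof -
  have eq: "frechet_derivative (\<lambda>y. local_rep2 M\<^sub>h m\<^sub>h i y b c) (at (chart M i p)) a = jacobi_deriv i p a b c" for a b c
    using frechet_derivative_eqI[OF has_derivative_rep_sublevel[OF p i]] by simp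
  have lin1: "linear (\<lambda>a. jacobi_deriv i p a b c)" for b c
    using has_derivative_rep_sublevel[OF p i] has_derivative_linear by blast
  have bil: "\<forall>\<^sub>F y in nhds (chart M i p). bilinear (local_rep2 M\<^sub>h m\<^sub>h i y)"
    using eventually_sublevel[OF p i] by eventually_elim (use inner_form_sublevel in \<open>auto simp: inner_form_def\<close>)
  have lin2: "linear (\<lambda>b. jacobi_deriv i p a b c)" for a c
    by (rule linear_derivative_of_family[OF _ has_derivative_rep_sublevel[OF p i]])
      (use bil in eventually_elim, simp add: bilinear_def)
  have sym: "jacobi_deriv i p a b c = jacobi_deriv i p a c b" for a b c
    by (simp add: jacobi_deriv_def rep_deriv_metric_sym[OF i, of _ b c] metric_sym[OF i, of b c])
  show ?thesis
    using koszul[OF inner_form_sublevel[OF p i], of "jacobi_deriv i p", OF lin1 lin2 sym]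
    unfolding levi_civita_def eq by (simp add: rep_sublevel[OF p i])
qed

lemma sharp_sublevel:
  assumes p: "p \<in> points M\<^sub>h" and i: "i \<in> charts_at M p" and U: "U \<in> tangent_space M p"
  shows "sharp M\<^sub>h m\<^sub>h p (\<kappa> p U) \<in> tangent_space M p"
    "conf_factor p * metric_rep i p (sharp M\<^sub>h m\<^sub>h p (\<kappa> p U) i) \<eta> = gyro_rep i p (U i) \<eta>"
proof -
  let ?Q = "\<lambda>u. u \<in> tangent_space M p \<and> (\<forall>v\<in>tangent_space M p. m\<^sub>h p u v = \<kappa> p U v)"
  have rep: "m\<^sub>h p u v = conf_factor p * metric_rep i p (u i) (v i)" if "u \<in> tangent_space M p" "v \<in> tangent_space M p" for u v
    using rep_tangent[OF i that] by (simp add: jacobi_metric_def)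
  have K: "\<kappa> p U v = gyro_rep i p (U i) (v i)" if "v \<in> tangent_space M p" for v
    using rep_tangent[OF i U that] .
  have "linear (gyro_rep i p (U i))" using bilinear_rep[OF tensors(2) i] by (simp add: bilinear_def)
  then obtain a where a: "\<And>b. conf_factor p * metric_rep i p a b = gyro_rep i p (U i) b"
    using inner_form_riesz[OF inner_form_sublevel[OF p i]] unfolding rep_sublevel[OF p i] by metis
  have ex: "?Q (coord_vector M i p a)"
    using a by (simp add: coord_vector_tangent[OF i] rep K coord_vector_self[OF i])
  have un: "u = coord_vector M i p a" if "?Q u" for u
  proof -
    have "conf_factor p * metric_rep i p (u i) b = gyro_rep i p (U i) b" for b
      using that coord_vector_tangent[OF i, of b] by (metis rep K coord_vector_self[OF i])
    then have "u i = a"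
      using inner_form_ext[OF inner_form_sublevel[OF p i]] a unfolding rep_sublevel[OF p i] by metis
    then show ?thesis using that coord_vector_eq[OF _ i] by metis
  qed
  have "?Q (sharp M\<^sub>h m\<^sub>h p (\<kappa> p U))"
    unfolding sharp_def tangent_space_sublevel[OF p] by (rule theI[of ?Q, OF ex un])
  then have eq: "sharp M\<^sub>h m\<^sub>h p (\<kappa> p U) = coord_vector M i p a" by (rule un)
  show "sharp M\<^sub>h m\<^sub>h p (\<kappa> p U) \<in> tangent_space M p"
    "conf_factor p * metric_rep i p (sharp M\<^sub>h m\<^sub>h p (\<kappa> p U) i) \<eta> = gyro_rep i p (U i) \<eta>"
    unfolding eq using a by (simp_all add: coord_vector_tangent[OF i] coord_vector_self[OF i])
qed

text \<open>
  The heart of the proof: for a vector \<open>U\<close> of unit length for \<open>m\<^sub>h\<close>, the geodesic equation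
  twisted by \<open>\<kappa>\<close>, lowered by \<open>m\<^sub>h\<close> and multiplied by the conformal factor \<open>f\<close>, is Newton's equation
  for \<open>v = f U\<close>. The acceleration on the right
  is \<open>dv/dt\<close> expressed by \<open>Y' = dU/d\<tau>\<close>: since \<open>d/dt = f d/d\<tau>\<close> and \<open>df = - 2 dV\<close>, it equals
  \<open>f (f Y' + df(U) U)\<close>. The unit length is what turns the term \<open>\<langle>U, U\<rangle> dV\<close> of the conformal change
  into the potential force.
\<close>

lemma gyroscopic_geodesic_iff_newton:
  assumes p: "p \<in> points M\<^sub>h" and i: "i \<in> charts_at M p" and U: "U \<in> tangent_space M p"
    and unit: "m\<^sub>h p U U = 1"
  shows "(- sharp M\<^sub>h m\<^sub>h p (\<kappa> p U)) i = Y' + levi_civita M\<^sub>h m\<^sub>h i (chart M i p) (U i) (U i) \<longleftrightarrow>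
    newton i p (conf_factor p *\<^sub>R U i) ((conf_factor p)\<^sup>2 *\<^sub>R Y' - (2 * conf_factor p * potential_deriv i p (U i)) *\<^sub>R U i)"
proof -
  define u s f where "u = U i" and "s = sharp M\<^sub>h m\<^sub>h p (\<kappa> p U) i" and "f = conf_factor p"
  define \<Gamma> where "\<Gamma> = levi_civita M\<^sub>h m\<^sub>h i (chart M i p) u u"
  have f: "f > 0" using p by (simp add: points_sublevel f_def)
  have one: "f * metric_rep i p u u = 1"
    using unit rep_tangent[OF i U U] by (simp add: jacobi_metric_def f_def u_def)
  have s: "f * metric_rep i p s \<eta> = gyro_rep i p u \<eta>" for \<eta>
    using sharp_sublevel(2)[OF p i U] by (simp add: f_def u_def s_def)
  have \<Gamma>: "f * metric_rep i p \<Gamma> \<eta> = f * rep_deriv m i p u u \<eta> - f * rep_deriv m i p \<eta> u u / 2 -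
      2 * potential_deriv i p u * metric_rep i p u \<eta> + potential_deriv i p \<eta> * metric_rep i p u u" for \<eta>
    using levi_civita_sublevel[OF p i, of "U i" "U i" \<eta>]
    unfolding jacobi_deriv_def f_def[symmetric] u_def[symmetric] \<Gamma>_def[symmetric] by simp
  note bil = bilinear_rep[OF tensors(1) i] bilinear_rep[OF tensors(2) i]
  let ?L = "\<lambda>\<eta>. f * metric_rep i p (Y' + \<Gamma> + s) \<eta>"
  have key: "metric_rep i p (f\<^sup>2 *\<^sub>R Y' - (2 * f * potential_deriv i p u) *\<^sub>R u) \<eta> +
      rep_deriv m i p (f *\<^sub>R u) (f *\<^sub>R u) \<eta> - rep_deriv m i p \<eta> (f *\<^sub>R u) (f *\<^sub>R u) / 2 +
      gyro_rep i p (f *\<^sub>R u) \<eta> + potential_deriv i p \<eta> = f * ?L \<eta>" for \<eta>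
  proof -
    have L: "?L \<eta> = f * metric_rep i p Y' \<eta> + (f * metric_rep i p \<Gamma> \<eta>) + f * metric_rep i p s \<eta>"
      by (simp add: bilinear_ladd[OF bil(1)] algebra_simps)
    have "f * ?L \<eta> = f\<^sup>2 * metric_rep i p Y' \<eta> + (f\<^sup>2 * rep_deriv m i p u u \<eta> - f\<^sup>2 * rep_deriv m i p \<eta> u u / 2 -
      2 * f * potential_deriv i p u * metric_rep i p u \<eta> + potential_deriv i p \<eta> * (f * metric_rep i p u u)) +
      f * gyro_rep i p u \<eta>"
      unfolding L \<Gamma> s by (simp add: algebra_simps power2_eq_square)
    then show ?thesis
      unfolding one
      by (simp add: bilinear_lsub[OF bil(1)] bilinear_lmul[OF bil(1)] bilinear_lmul[OF bil(2)]
          linear_scale[OF linear_rep_deriv(1)[OF tensors(1) i]] linear_scale[OF linear_rep_deriv(2)[OF tensors(1) i]]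
          linear_scale[OF linear_rep_deriv(3)[OF tensors(1) i]] power2_eq_square)
  qed
  have "newton i p (f *\<^sub>R u) (f\<^sup>2 *\<^sub>R Y' - (2 * f * potential_deriv i p u) *\<^sub>R u) \<longleftrightarrow>
      (\<forall>\<eta>. metric_rep i p (Y' + \<Gamma> + s) \<eta> = 0)"
    unfolding newton_def key using f by simp
  also have "\<dots> \<longleftrightarrow> Y' + \<Gamma> + s = 0"
    using inner_form_ext[OF inner_form_metric[OF i], of "Y' + \<Gamma> + s" 0]
    by (auto simp: bilinear_lzero[OF bil(1)])
  also have "\<dots> \<longleftrightarrow> - s = Y' + \<Gamma>" by (metis add.inverse_inverse add_eq_0_iff2 eq_neg_iff_add_eq_0)
  finally show ?thesis by (simp add: u_def s_def \<Gamma>_def f_def)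
qed

lemma has_derivative_factor:
  assumes c: "has_velocity M c t \<xi>" and i: "i \<in> charts_at M (c t)"
  shows "((\<lambda>s. conf_factor (c s)) has_real_derivative (- 2 * potential_deriv i (c t) (\<xi> i))) (at t)"
proof -
  have "((\<lambda>s. (V \<circ> chart_inv M i) (chart M i (c s))) has_derivative
      (\<lambda>k. potential_deriv i (c t) (k *\<^sub>R \<xi> i))) (at t)"
    by (rule has_derivative_compose[OF has_velocityD(4)[OF c i, unfolded has_vector_derivative_def]
       has_derivative_potential[OF i]])
  then have "((\<lambda>s. V (c s)) has_derivative (\<lambda>k. potential_deriv i (c t) (k *\<^sub>R \<xi> i))) (at t)"
    by (rule has_derivative_cong_ev)
      (use has_velocityD(3)[OF c i] in eventually_elim, simp add: chart_inv_chart)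
  then have "((\<lambda>s. V (c s)) has_real_derivative potential_deriv i (c t) (\<xi> i)) (at t)"
    unfolding has_field_derivative_def
    by (rule has_derivative_eq_rhs) (simp add: linear_scale[OF linear_potential_deriv[OF i]] fun_eq_iff)
  then show ?thesis by (auto intro!: derivative_eq_intros)
qed

end


section \<open>Changes of parameter\<close>

lemma open_interval_subset:
  assumes "open_interval I" "t \<in> I"
  obtains a b where "a < t" "t < b" "{a..b} \<subseteq> I"
proof -
  have "open I" using assms by (simp add: open_interval_def)
  then obtain e where e: "e > 0" "cball t e \<subseteq> I" using assms(2) open_contains_cball by blast
  then show ?thesis using that[of "t - e" "t + e"] by (simp add: cball_eq_atLeastAtMost)
qed

lemma open_interval_Icc: "open_interval I \<Longrightarrow> a \<in> I \<Longrightarrow> b \<in> I \<Longrightarrow> {a..b} \<subseteq> I"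
  by (auto simp: open_interval_def intro: mem_is_interval_1_I)

lemma open_interval_eventually: "open_interval I \<Longrightarrow> t \<in> I \<Longrightarrow> \<forall>\<^sub>F s in nhds t. s \<in> I"
  by (simp add: open_interval_def eventually_nhds_in_open)

lemma has_derivative_of_increments:
  fixes s f :: "real \<Rightarrow> real"
  assumes I: "open_interval I" and f: "continuous_on I f"
    and s: "\<And>a b. a \<in> I \<Longrightarrow> b \<in> I \<Longrightarrow> a \<le> b \<Longrightarrow> s b - s a = integral {a..b} f"
    and t: "t \<in> I"
  shows "(s has_real_derivative f t) (at t)"
proof -
  obtain a b where ab: "a < t" "t < b" "{a..b} \<subseteq> I" using open_interval_subset[OF I t] by blast
  have "((\<lambda>u. integral {a..u} f) has_vector_derivative f t) (at t within {a..b})"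
    using ab by (intro integral_has_vector_derivative continuous_on_subset[OF f]) auto
  then have "((\<lambda>u. s a + integral {a..u} f) has_derivative (\<lambda>h. 0 + h *\<^sub>R f t)) (at t)"
    using ab unfolding has_vector_derivative_def at_within_Icc_at[OF ab(1,2)]
    by (intro has_derivative_add has_derivative_const)
  then have "(s has_derivative (\<lambda>h. 0 + h *\<^sub>R f t)) (at t)"
  proof (rule has_derivative_transform_within_open[of _ _ _ _ "{a<..<b}"])
    fix u assume "u \<in> {a<..<b}"
    then show "s a + integral {a..u} f = s u" using ab s[of a u] by (auto simp: subset_iff)
  qed (use ab in auto)
  then show ?thesis unfolding has_field_derivative_def by (rule has_derivative_eq_rhs) (auto simp: fun_eq_iff)
qed

lemma antiderivative_exists:
  fixes f :: "real \<Rightarrow> real"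
  assumes I: "open_interval I" and f: "continuous_on I f"
  obtains T where "\<And>t. t \<in> I \<Longrightarrow> (T has_real_derivative f t) (at t)"
proof -
  obtain c where c: "c \<in> I" using I by (auto simp: open_interval_def)
  define T where "T = (\<lambda>t. if c \<le> t then integral {c..t} f else - integral {t..c} f)"
  have int: "f integrable_on {a..b}" if "a \<in> I" "b \<in> I" for a b
    using open_interval_Icc[OF I that] by (intro integrable_continuous_real continuous_on_subset[OF f])
  have "T b - T a = integral {a..b} f" if "a \<in> I" "b \<in> I" "a \<le> b" for a b
  proof -
    consider "c \<le> a" | "a < c" "c \<le> b" | "b < c" by linarith
    then show ?thesis
    proof cases
      case 1
      then show ?thesis
        using that Henstock_Kurzweil_Integration.integral_combine[OF 1 that(3) int[OF c that(2)]] by (simp add: T_def)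
    next
      case 2
      then show ?thesis
        using that Henstock_Kurzweil_Integration.integral_combine[OF _ 2(2) int[OF that(1,2)]] by (simp add: T_def)
    next
      case 3
      then show ?thesis
        using that Henstock_Kurzweil_Integration.integral_combine[OF that(3) _ int[OF that(1) c]] by (simp add: T_def)
    qed
  qed
  from has_derivative_of_increments[OF I f this] show ?thesis by (rule that)
qed

text \<open>
  A positive derivative makes \<open>s\<close> strictly increasing. Continuity and differentiability of the inverse
  are then supplied by the strong inverse function theorem.
\<close>

lemma parameter_inverse:
  fixes s f :: "real \<Rightarrow> real"
  assumes I: "open_interval I"
    and s: "\<And>t. t \<in> I \<Longrightarrow> (s has_real_derivative f t) (at t)" and f: "\<And>t. t \<in> I \<Longrightarrow> f t > 0"
  shows "inj_on s I" "open_interval (s ` I)"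
    "t \<in> I \<Longrightarrow> (inv_into I s has_real_derivative 1 / f t) (at (s t))"
proof -
  have mono: "s a < s b" if "a \<in> I" "b \<in> I" "a < b" for a b
  proof (rule DERIV_pos_imp_increasing[OF that(3)])
    fix x assume "a \<le> x" "x \<le> b"
    then have "x \<in> I" using open_interval_Icc[OF I that(1,2)] by auto
    then show "\<exists>y. (s has_real_derivative y) (at x) \<and> y > 0" using s f by blast
  qed
  show inj: "inj_on s I" using mono by (intro inj_onI) (metis less_irrefl linorder_less_linear)
  have cont: "continuous_on I s"
    using s DERIV_isCont continuous_at_imp_continuous_on by blast
  show "open_interval (s ` I)"
    using I invariance_of_domain[OF cont _ inj] connected_continuous_image[OF cont]
    by (auto simp: open_interval_def is_interval_connected_1)
  assume t: "t \<in> I"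
  have "(inv_into I s has_derivative (*) (1 / f t)) (at (s t))"
  proof (rule has_derivative_inverse_strong[where f = s and x = t])
    show "open I" using I by (simp add: open_interval_def)
    show "inv_into I s (s x) = x" if "x \<in> I" for x using inj that by simp
    show "(s has_derivative (*) (f t)) (at t)" using s[OF t] by (simp add: has_field_derivative_def)
    show "(*) (f t) \<circ> (*) (1 / f t) = id" using f[OF t] by (auto simp: fun_eq_iff)
  qed (use t cont in auto)
  then show "(inv_into I s has_real_derivative 1 / f t) (at (s t))" by (simp add: has_field_derivative_def)
qed


section \<open>Motions and geodesics of the Jacobi metric\<close>

context jacobi
begin

lemma factor_pos: "p \<in> points M\<^sub>h \<Longrightarrow> conf_factor p > 0"
  by (simp add: points_sublevel)

lemma factor_continuous:
  assumes "\<And>t. t \<in> I \<Longrightarrow> has_velocity M c t (\<xi> t)"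
  shows "continuous_on I (\<lambda>t. conf_factor (c t))"
proof (rule continuous_at_imp_continuous_on, rule ballI)
  fix t assume "t \<in> I"
  then obtain i where "i \<in> charts_at M (c t)" using assms has_velocityD(1) points_iff by blast
  then show "isCont (\<lambda>t. conf_factor (c t)) t" using has_derivative_factor[OF assms[OF \<open>t \<in> I\<close>]] DERIV_isCont by blast
qed

text \<open>
  A curve with \<open>\<langle>v, v\<rangle> = f\<close> has speed \<open>f\<close> for the metric \<open>f m\<close>, as the square root of \<open>f \<langle>v, v\<rangle> = f\<^sup>2\<close>.
\<close>

lemma curve_length_integral:
  assumes "\<And>t. t \<in> {a..b} \<Longrightarrow> c t \<in> points M\<^sub>h \<and> has_velocity M c t (v t) \<and> m (c t) (v t) (v t) = conf_factor (c t)"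
  shows "curve_length M\<^sub>h m\<^sub>h a b c = integral {a..b} (\<lambda>t. conf_factor (c t))"
  unfolding curve_length_def
proof (rule integral_cong)
  fix t assume "t \<in> {a..b}"
  then have t: "c t \<in> points M\<^sub>h" "has_velocity M c t (v t)" "m (c t) (v t) (v t) = conf_factor (c t)"
    using assms by auto
  have "velocity M\<^sub>h c t = v t" using t velocity_sublevel velocity_eqI by metis
  then show "sqrt (m\<^sub>h (c t) (velocity M\<^sub>h c t) (velocity M\<^sub>h c t)) = conf_factor (c t)"
    using factor_pos[OF t(1)] by (simp only: jacobi_metric_def t(3) real_sqrt_abs2 abs_of_pos)
qed

text \<open>
  The arclength \<open>s\<close> has derivative \<open>f > 0\<close>, so it can be inverted and \<open>y = x \<circ> s\<^sup>-\<^sup>1\<close> has the velocity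
  \<open>U = v / f\<close> and a second derivative in every chart. The pointwise equivalence does the rest.
\<close>

lemma motion_imp_gyroscopic_geodesic:
  assumes mot: "motion M m V \<kappa> I x" and xh: "\<And>t. t \<in> I \<Longrightarrow> x t \<in> points M\<^sub>h"
    and energy: "\<And>t. t \<in> I \<Longrightarrow> total_energy M m V x t = h"
    and arc: "arclength_reparametrization M\<^sub>h m\<^sub>h I x J y"
  shows "gyroscopic_geodesic M\<^sub>h m\<^sub>h \<kappa> J y"
proof -
  obtain w where w: "integral_curve TM (dynamical_system M m V \<kappa>) I w" and xw: "\<And>t. t \<in> I \<Longrightarrow> x t = fst (w t)"
    using mot by (auto simp: motion_def)
  have I: "open_interval I" and wv: "\<And>t. t \<in> I \<Longrightarrow> has_velocity TM w t (dynamical_system M m V \<kappa> (w t))"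
    using w by (auto simp: integral_curve_def)
  define v where "v = (\<lambda>t. snd (w t))"
  have x: "has_velocity M x t (v t)" if t: "t \<in> I" for t
    unfolding v_def
    by (rule has_velocity_cong_ev[OF motion_velocity(1)[OF wv[OF t]]])
      (use open_interval_eventually[OF I t] in eventually_elim, simp add: xw)
  have accel: "\<exists>a. ((\<lambda>s. v s i) has_vector_derivative a) (at t) \<and> newton i (x t) (v t i) a"
    if t: "t \<in> I" and i: "i \<in> charts_at M (x t)" for t i
    using motion_velocity(2)[OF wv[OF t], of i] i xw[OF t] by (simp add: v_def)
  have speed: "m (x t) (v t) (v t) = conf_factor (x t)" if t: "t \<in> I" for t
    using energy[OF t] velocity_eqI[OF x[OF t]] by (simp add: total_energy_def)
  obtain s where s: "s ` I = J" "\<And>a b. a \<in> I \<Longrightarrow> b \<in> I \<Longrightarrow> a \<le> b \<Longrightarrow> s b - s a = curve_length M\<^sub>h m\<^sub>h a b x"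
    "\<And>t. t \<in> I \<Longrightarrow> y (s t) = x t"
    using arc by (auto simp: arclength_reparametrization_def)
  have ds: "(s has_real_derivative conf_factor (x t)) (at t)" if "t \<in> I" for t
  proof (rule has_derivative_of_increments[OF I factor_continuous[OF x] _ that])
    fix a b assume ab: "a \<in> I" "b \<in> I" "a \<le> b"
    have "curve_length M\<^sub>h m\<^sub>h a b x = integral {a..b} (\<lambda>t. conf_factor (x t))"
      by (rule curve_length_integral) (use open_interval_Icc[OF I ab(1,2)] xh x speed in blast)
    then show "s b - s a = integral {a..b} (\<lambda>t. conf_factor (x t))" using s(2)[OF ab] by simp
  qed
  define \<sigma> where "\<sigma> = inv_into I s"
  have inv: "open_interval (s ` I)"
    "\<And>t. t \<in> I \<Longrightarrow> (inv_into I s has_real_derivative 1 / conf_factor (x t)) (at (s t))"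
    using parameter_inverse(2,3)[OF I, of s "\<lambda>t. conf_factor (x t)"] ds factor_pos[OF xh] by blast+
  have J: "open_interval J" using inv(1) s(1) by simp
  have \<sigma>I: "\<sigma> \<tau> \<in> I" and s\<sigma>: "s (\<sigma> \<tau>) = \<tau>" if "\<tau> \<in> J" for \<tau>
    using that s(1) by (auto simp: \<sigma>_def inv_into_into f_inv_into_f)
  have y: "y \<tau> = x (\<sigma> \<tau>)" if "\<tau> \<in> J" for \<tau> using s(3)[OF \<sigma>I[OF that]] s\<sigma>[OF that] by simp
  have d\<sigma>: "(\<sigma> has_real_derivative 1 / conf_factor (y \<tau>)) (at \<tau>)" if "\<tau> \<in> J" for \<tau>
    using inv(2)[OF \<sigma>I[OF that]] by (simp only: \<sigma>_def[symmetric] s\<sigma>[OF that] y[OF that])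
  have yh: "y \<tau> \<in> points M\<^sub>h" if "\<tau> \<in> J" for \<tau> using xh[OF \<sigma>I[OF that]] y[OF that] by simp
  define U where "U = (\<lambda>\<tau> i. (1 / conf_factor (y \<tau>)) *\<^sub>R v (\<sigma> \<tau>) i)"
  have U: "has_velocity M y \<tau> (U \<tau>)" if \<tau>: "\<tau> \<in> J" for \<tau>
  proof (rule has_velocity_cong_ev)
    show "has_velocity M (x \<circ> \<sigma>) \<tau> (U \<tau>)"
      unfolding U_def by (rule has_velocity_reparametrize[where r = \<sigma>, OF x[OF \<sigma>I[OF \<tau>]] d\<sigma>[OF \<tau>]])
    show "\<forall>\<^sub>F r in nhds \<tau>. (x \<circ> \<sigma>) r = y r"
      using open_interval_eventually[OF J \<tau>] by eventually_elim (simp add: y)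
  qed
  have vel: "velocity M\<^sub>h y \<tau> = U \<tau>" if "\<tau> \<in> J" for \<tau>
    using velocity_eqI[OF U[OF that]] velocity_sublevel[where c = y, OF yh[OF that]] by simp
  show ?thesis
    unfolding gyroscopic_geodesic_def
  proof
    fix \<tau> assume \<tau>: "\<tau> \<in> J"
    define p where "p = y \<tau>"
    have p: "p \<in> points M\<^sub>h" using yh[OF \<tau>] by (simp add: p_def)
    have f: "conf_factor p > 0" by (rule factor_pos[OF p])
    have UT: "U \<tau> \<in> tangent_space M p" using has_velocityD(2)[OF U[OF \<tau>]] by (simp add: p_def)
    have vT: "v (\<sigma> \<tau>) \<in> tangent_space M p" using has_velocityD(2)[OF x[OF \<sigma>I[OF \<tau>]]] y[OF \<tau>] by (simp add: p_def)
    have vU: "v (\<sigma> \<tau>) i = conf_factor p *\<^sub>R U \<tau> i" for i using f by (simp add: U_def p_def)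
    have unit: "m\<^sub>h p (U \<tau>) (U \<tau>) = 1" if i: "i \<in> charts_at M p" for i
    proof -
      have "m p (v (\<sigma> \<tau>)) (v (\<sigma> \<tau>)) = conf_factor p" using speed[OF \<sigma>I[OF \<tau>]] y[OF \<tau>] by (simp add: p_def)
      then have "conf_factor p * (conf_factor p * m p (U \<tau>) (U \<tau>)) = conf_factor p"
        by (simp only: rep_tangent[OF i vT vT] rep_tangent[OF i UT UT] vU bilinear_lmul[OF bilinear_rep[OF tensors(1) i]]
            bilinear_rmul[OF bilinear_rep[OF tensors(1) i]] real_scaleR_def)
      then show ?thesis using f unfolding jacobi_metric_def by (metis mult_cancel_left2 less_irrefl)
    qed
    have "\<exists>Y'. ((\<lambda>r. velocity M\<^sub>h y r i) has_vector_derivative Y') (at \<tau>) \<and>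
       (- sharp M\<^sub>h m\<^sub>h p (\<kappa> p (U \<tau>))) i = Y' + levi_civita M\<^sub>h m\<^sub>h i (chart M i p) (U \<tau> i) (U \<tau> i)"
      if i: "i \<in> charts_at M p" for i
    proof -
      obtain a where a: "((\<lambda>s. v s i) has_vector_derivative a) (at (\<sigma> \<tau>))" "newton i p (v (\<sigma> \<tau>) i) a"
        using accel[OF \<sigma>I[OF \<tau>]] i y[OF \<tau>] by (auto simp: p_def)
      define dF where "dF = - 2 * potential_deriv i p (U \<tau> i)"
      \<comment> \<open>\<open>Y' = dU/d\<tau>\<close>, by the product rule for \<open>U = (1 / f) v\<close> and \<open>dv/d\<tau> = a / f\<close>\<close>
      define Y' where "Y' = (1 / conf_factor p) *\<^sub>R ((1 / conf_factor p) *\<^sub>R a) + (- dF / (conf_factor p)\<^sup>2) *\<^sub>R v (\<sigma> \<tau>) i"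
      have 1: "((\<lambda>r. v (\<sigma> r) i) has_vector_derivative (1 / conf_factor p) *\<^sub>R a) (at \<tau>)"
        using vector_diff_chain_at[OF d\<sigma>[OF \<tau>, unfolded has_real_derivative_iff_has_vector_derivative] a(1)]
        by (simp add: o_def p_def)
      have 0: "((\<lambda>r. conf_factor (y r)) has_real_derivative dF) (at \<tau>)"
        using has_derivative_factor[OF U[OF \<tau>]] i by (simp add: p_def dF_def)
      then have 2: "((\<lambda>r. 1 / conf_factor (y r)) has_real_derivative - dF / (conf_factor p)\<^sup>2) (at \<tau>)"
        using DERIV_divide[OF DERIV_const[of 1] 0] f
        by (simp only: p_def power2_eq_square mult_zero_left mult_1 diff_0 less_irrefl not_False_eq_True
            order_less_imp_not_eq2)
      have rescale: "f\<^sup>2 *\<^sub>R ((1 / f) *\<^sub>R ((1 / f) *\<^sub>R b) + (- d / f\<^sup>2) *\<^sub>R (f *\<^sub>R c)) =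
          b + (- d * f) *\<^sub>R c" if "f \<noteq> 0" for f d :: real and b c :: 'e
        using that by (simp add: scaleR_add_right scaleR_right_diff_distrib power2_eq_square)
      have "((\<lambda>r. U r i) has_vector_derivative Y') (at \<tau>)"
        unfolding U_def Y'_def using has_vector_derivative_scaleR[OF 2 1] by (simp add: p_def)
      then have "((\<lambda>r. velocity M\<^sub>h y r i) has_vector_derivative Y') (at \<tau>)"
        unfolding has_vector_derivative_def
        by (rule has_derivative_cong_ev) (use open_interval_eventually[OF J \<tau>] in eventually_elim, simp add: vel)
      moreover have "(conf_factor p)\<^sup>2 *\<^sub>R Y' - (2 * conf_factor p * potential_deriv i p (U \<tau> i)) *\<^sub>R U \<tau> i = a"
      proof -
        have "(conf_factor p)\<^sup>2 *\<^sub>R Y' = a + (- dF * conf_factor p) *\<^sub>R U \<tau> i"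
          unfolding Y'_def vU by (rule rescale) (use f in linarith)
        then show ?thesis by (simp add: dF_def algebra_simps del: distrib_left_numeral right_diff_distrib_numeral)
      qed
      ultimately show ?thesis
        using gyroscopic_geodesic_iff_newton[OF p i UT unit[OF i], of Y'] a(2) unfolding vU by metis
    qed
    moreover have "- sharp M\<^sub>h m\<^sub>h p (\<kappa> p (U \<tau>)) \<in> tangent_space M p"
    proof -
      obtain i where "i \<in> charts_at M p" using p points_iff points_sublevel by blast
      from scaleR_tangent[OF sharp_sublevel(1)[OF p this UT], of "-1"] show ?thesis by (simp add: fun_Compl_def)
    qed
    ultimately show "has_covariant_derivative M\<^sub>h m\<^sub>h y (velocity M\<^sub>h y) \<tau>
        (- sharp M\<^sub>h m\<^sub>h (y \<tau>) (\<kappa> (y \<tau>) (velocity M\<^sub>h y \<tau>)))"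
      unfolding has_covariant_derivative_def
      using U[OF \<tau>] p
      by (simp add: vel[OF \<tau>] has_velocity_sublevel p_def[symmetric] tangent_space_sublevel charts_at_sublevel sublevel_simps(1))
  qed
qed

text \<open>
  Arclength is only assumed in integrated form; the speed \<open>g\<close> is continuous because the equation
  provides a derivative of the velocity, so differentiating the length yields \<open>g = 1\<close>. The physical
  time \<open>T\<close> is a primitive of \<open>1 / f\<close> along the curve, and its inverse \<open>s\<close> is the change of parameter.
  The lifted curve \<open>(y \<circ> s, f U)\<close> satisfies Newton's equation in the chosen chart at each of its
  points, and therefore is an integral curve.
\<close>

lemma gyroscopic_geodesic_imp_motion:
  assumes yh: "\<And>\<tau>. \<tau> \<in> J \<Longrightarrow> y \<tau> \<in> points M\<^sub>h"
    and arc: "parametrized_by_arclength M\<^sub>h m\<^sub>h J y"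
    and geod: "gyroscopic_geodesic M\<^sub>h m\<^sub>h \<kappa> J y"
  shows "\<exists>I s. open_interval I \<and> parameter_change I J s \<and> motion M m V \<kappa> I (y \<circ> s) \<and>
    (\<forall>t\<in>I. total_energy M m V (y \<circ> s) t = h)"
proof -
  define U where "U = velocity M\<^sub>h y"
  have J: "open_interval J" using arc by (simp add: parametrized_by_arclength_def differentiable_curve_def)
  have U: "has_velocity M y \<tau> (U \<tau>)" if "\<tau> \<in> J" for \<tau>
    using arc that unfolding has_velocity_sublevel[where c = y, OF yh[OF that], symmetric]
    by (simp add: parametrized_by_arclength_def differentiable_curve_def U_def)
  have UT: "U \<tau> \<in> tangent_space M (y \<tau>)" if "\<tau> \<in> J" for \<tau> using has_velocityD(2)[OF U[OF that]] .
  have geod': "\<exists>Y'. ((\<lambda>r. U r i) has_vector_derivative Y') (at \<tau>) \<and>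
       (- sharp M\<^sub>h m\<^sub>h (y \<tau>) (\<kappa> (y \<tau>) (U \<tau>))) i =
       Y' + levi_civita M\<^sub>h m\<^sub>h i (chart M i (y \<tau>)) (U \<tau> i) (U \<tau> i)"
    if \<tau>: "\<tau> \<in> J" and i: "i \<in> charts_at M (y \<tau>)" for \<tau> i
    using geod \<tau> i yh[OF \<tau>]
    by (auto simp: gyroscopic_geodesic_def has_covariant_derivative_def charts_at_sublevel sublevel_simps(1) U_def)
  have ev: "\<forall>\<^sub>F r in nhds \<tau>. r \<in> J \<and> i \<in> charts_at M (y r)" if "\<tau> \<in> J" "i \<in> charts_at M (y \<tau>)" for \<tau> i
    using open_interval_eventually[OF J that(1)] has_velocityD(3)[OF U[OF that(1)] that(2)]
    by eventually_elim simp
  define g where "g = (\<lambda>\<tau>. sqrt (m\<^sub>h (y \<tau>) (U \<tau>) (U \<tau>)))"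
  have "continuous_on J g"
  proof (rule continuous_at_imp_continuous_on, rule ballI)
    fix \<tau> assume \<tau>: "\<tau> \<in> J"
    obtain i where i: "i \<in> charts_at M (y \<tau>)" using has_velocityD(1)[OF U[OF \<tau>]] points_iff by blast
    obtain Y' where Y': "((\<lambda>r. U r i) has_vector_derivative Y') (at \<tau>)" using geod'[OF \<tau> i] by blast
    have "isCont (\<lambda>r. local_rep2 M m i (chart M i (y r)) (U r i) (U r i)) \<tau>"
      using has_derivative_rep_along[OF tensors(1) i has_velocityD(4)[OF U[OF \<tau>] i, unfolded has_vector_derivative_def] refl
          Y'[unfolded has_vector_derivative_def] Y'[unfolded has_vector_derivative_def]]
        has_derivative_continuous by blast
    moreover have "isCont (\<lambda>r. conf_factor (y r)) \<tau>" using has_derivative_factor[OF U[OF \<tau>] i] DERIV_isCont by blast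
    ultimately have "isCont (\<lambda>r. sqrt (conf_factor (y r) * local_rep2 M m i (chart M i (y r)) (U r i) (U r i))) \<tau>"
      by (intro continuous_real_sqrt continuous_mult[of _ "\<lambda>r. conf_factor (y r)"])
    moreover have "\<forall>\<^sub>F r in nhds \<tau>. sqrt (conf_factor (y r) * local_rep2 M m i (chart M i (y r)) (U r i) (U r i)) = g r"
      using ev[OF \<tau> i]
    proof eventually_elim
      case (elim r)
      then show ?case
        using rep_tangent[of i "y r" "U r" "U r" m] UT[of r] by (simp add: g_def jacobi_metric_def)
    qed
    ultimately show "isCont g \<tau>" by (rule iffD1[OF isCont_cong, rotated])
  qed
  have unit: "m\<^sub>h (y \<tau>) (U \<tau>) (U \<tau>) = 1" if \<tau>: "\<tau> \<in> J" for \<tau>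
  proof -
    \<comment> \<open>the arclength of \<open>y\<close> is the identity, so its derivative is both 1 and the speed\<close>
    have "((\<lambda>r. r) has_real_derivative g \<tau>) (at \<tau>)"
    proof (rule has_derivative_of_increments[OF J \<open>continuous_on J g\<close> _ \<tau>])
      fix a b assume "a \<in> J" "b \<in> J" "a \<le> b"
      then show "b - a = integral {a..b} g"
        using arc by (simp add: parametrized_by_arclength_def curve_length_def g_def U_def)
    qed
    then have "g \<tau> = 1" using DERIV_ident DERIV_unique by blast
    then show ?thesis by (simp add: g_def)
  qed
  have "continuous_on J (\<lambda>\<tau>. 1 / conf_factor (y \<tau>))"
  proof (rule continuous_on_divide[OF continuous_on_const factor_continuous[OF U]])
    show "\<forall>\<tau>\<in>J. conf_factor (y \<tau>) \<noteq> 0" using factor_pos[OF yh] by (metis less_irrefl)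
  qed
  then obtain T where T: "\<And>\<tau>. \<tau> \<in> J \<Longrightarrow> (T has_real_derivative 1 / conf_factor (y \<tau>)) (at \<tau>)"
    using antiderivative_exists[OF J] by blast
  have "1 / conf_factor (y \<tau>) > 0" if "\<tau> \<in> J" for \<tau> using factor_pos[OF yh[OF that]] by (rule divide_pos_pos[OF zero_less_one])
  then have inv: "inj_on T J" "open_interval (T ` J)"
    "\<And>\<tau>. \<tau> \<in> J \<Longrightarrow> (inv_into J T has_real_derivative 1 / (1 / conf_factor (y \<tau>))) (at (T \<tau>))"
    using parameter_inverse[OF J, of T "\<lambda>\<tau>. 1 / conf_factor (y \<tau>)"] T by blast+
  define I where "I = T ` J"
  define s where "s = inv_into J T"
  have I: "open_interval I" using inv(2) by (simp add: I_def)
  have sJ: "s t \<in> J" and Ts: "T (s t) = t" if "t \<in> I" for t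
    using that by (auto simp: I_def s_def inv_into_into f_inv_into_f)
  have ds: "(s has_real_derivative conf_factor (y (s t))) (at t)" if "t \<in> I" for t
    using inv(3)[OF sJ[OF that]] by (simp only: s_def[symmetric] Ts[OF that]) simp
  define v where "v = (\<lambda>t i. conf_factor (y (s t)) *\<^sub>R U (s t) i)"
  have x: "has_velocity M (y \<circ> s) t (v t)" if t: "t \<in> I" for t
    unfolding v_def by (rule has_velocity_reparametrize[where r = s, OF U[OF sJ[OF t]] ds[OF t]])
  have vT: "v t \<in> tangent_space M (y (s t))" if "t \<in> I" for t
    using has_velocityD(2)[OF x[OF that]] by simp
  have "parameter_change I J s"
    unfolding parameter_change_def
  proof (intro conjI exI[of _ "\<lambda>t. conf_factor ((y \<circ> s) t)"] ballI)
    show "bij_betw s I J" unfolding I_def s_def by (rule bij_betw_inv_into[OF inj_on_imp_bij_betw[OF inv(1)]])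
    show "continuous_on I (\<lambda>t. conf_factor ((y \<circ> s) t))" by (rule factor_continuous[OF x])
    show "(s has_real_derivative conf_factor ((y \<circ> s) t)) (at t)" "conf_factor ((y \<circ> s) t) > 0" if "t \<in> I" for t
      using ds[OF that] factor_pos[OF yh[OF sJ[OF that]]] by simp_all
  qed
  moreover have "total_energy M m V (y \<circ> s) t = h" if t: "t \<in> I" for t
  proof -
    define p where "p = y (s t)"
    obtain i where i: "i \<in> charts_at M p"
      using has_velocityD(1)[OF U[OF sJ[OF t]]] points_iff by (auto simp: p_def)
    have "m p (v t) (v t) = conf_factor p * (conf_factor p * m p (U (s t)) (U (s t)))"
      unfolding rep_tangent[OF i vT[OF t, folded p_def] vT[OF t, folded p_def]]
        rep_tangent[OF i UT[OF sJ[OF t], folded p_def] UT[OF sJ[OF t], folded p_def]]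
      by (simp only: v_def p_def[symmetric] bilinear_lmul[OF bilinear_rep[OF tensors(1) i]]
            bilinear_rmul[OF bilinear_rep[OF tensors(1) i]] real_scaleR_def)
    also have "\<dots> = conf_factor p" using unit[OF sJ[OF t]] by (simp add: jacobi_metric_def p_def)
    finally show ?thesis
      by (simp add: total_energy_def velocity_eqI[OF x[OF t]] p_def field_simps)
  qed
  moreover have "motion M m V \<kappa> I (y \<circ> s)"
    unfolding motion_def integral_curve_def
  proof (intro exI[of _ "\<lambda>t. (y (s t), v t)"] conjI ballI I)
    fix t assume t: "t \<in> I"
    show "(y \<circ> s) t = fst (y (s t), v t)" by simp
    define p i where "p = y (s t)" and "i = chart_at M p"
    have ph: "p \<in> points M\<^sub>h" using yh[OF sJ[OF t]] by (simp add: p_def)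
    then have p: "p \<in> points M" by (simp add: points_sublevel)
    have i: "i \<in> charts_at M p" using chart_at[OF p] by (simp add: i_def)
    have vTp: "v t \<in> tangent_space M p" using vT[OF t] by (simp add: p_def)
    have i': "i \<in> charts_at TM (p, v t)" using i vTp by (simp add: charts_at_bundle)
    define u where "u = U (s t) i"
    have vu: "v t i = conf_factor p *\<^sub>R u" by (simp add: v_def p_def u_def)
    obtain Y' where Y': "((\<lambda>r. U r i) has_vector_derivative Y') (at (s t))"
       "(- sharp M\<^sub>h m\<^sub>h p (\<kappa> p (U (s t)))) i = Y' + levi_civita M\<^sub>h m\<^sub>h i (chart M i p) u u"
      using geod'[OF sJ[OF t]] i by (auto simp: p_def u_def)
    define a where "a = (conf_factor p)\<^sup>2 *\<^sub>R Y' - (2 * conf_factor p * potential_deriv i p u) *\<^sub>R u"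
    have newton: "newton i p (v t i) a"
      using Y'(2) gyroscopic_geodesic_iff_newton[OF ph i UT[OF sJ[OF t], folded p_def] unit[OF sJ[OF t], folded p_def], of Y']
      unfolding a_def vu u_def by blast
    have 1: "((\<lambda>r. U (s r) i) has_vector_derivative conf_factor p *\<^sub>R Y') (at t)"
      using vector_diff_chain_at[OF ds[OF t, unfolded has_real_derivative_iff_has_vector_derivative] Y'(1)]
      by (simp add: o_def p_def)
    have 2: "((\<lambda>r. conf_factor (y (s r))) has_real_derivative (- 2 * potential_deriv i p (v t i))) (at t)"
      using has_derivative_factor[OF x[OF t], of i] i by (simp add: p_def)
    have "conf_factor p *\<^sub>R (conf_factor p *\<^sub>R Y') + (- 2 * potential_deriv i p (v t i)) *\<^sub>R u = a"
      by (simp add: a_def vu linear_scale[OF linear_potential_deriv[OF i]] power2_eq_square mult.assoc mult.left_commute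
         del: distrib_left_numeral right_diff_distrib_numeral)
    then have dv: "((\<lambda>r. v r i) has_vector_derivative a) (at t)"
      using has_vector_derivative_scaleR[OF 2 1] by (simp add: v_def u_def p_def)
    have dx: "((\<lambda>r. chart M i (y (s r))) has_vector_derivative v t i) (at t)"
      using has_velocityD(4)[OF x[OF t], of i] i by (simp add: p_def)
    have "has_velocity TM (\<lambda>t. (y (s t), v t)) t (coord_vector TM i (y (s t), v t) (v t i, a))"
    proof (rule tangent.has_velocity_from_chart)
      show "i \<in> charts_at TM (y (s t), v t)" using i' by (simp add: p_def)
      have "\<forall>\<^sub>F r in nhds t. i \<in> charts_at M (y (s r))" using has_velocityD(3)[OF x[OF t], of i] i by (simp add: p_def)
      then show "\<forall>\<^sub>F r in nhds t. (y (s r), v r) \<in> chart_dom TM i"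
        using open_interval_eventually[OF I t]
        by eventually_elim (simp add: tangent_bundle_simps vT charts_atD)
      show "((\<lambda>r. chart TM i (y (s r), v r)) has_vector_derivative (v t i, a)) (at t)"
        using has_vector_derivative_Pair[OF dx dv] by (simp add: tangent_bundle_simps(3))
    qed
    moreover have "coord_vector TM i (p, v t) (v t i, a) = dynamical_system M m V \<kappa> (p, v t)"
      using dynamical_system_iff[OF vTp i i_def] tangent.coord_vector_tangent[OF i'] tangent.coord_vector_self[OF i'] newton
      by simp
    ultimately show "has_velocity TM (\<lambda>t. (y (s t), v t)) t (dynamical_system M m V \<kappa> (y (s t), v t))"
      by (simp add: p_def)
  qed
  ultimately show ?thesis using I by blast
qed

end

theorem theorem2:
  fixes M :: "('i, 'a, 'e::euclidean_space) manifold"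
    and m \<kappa> :: "('i, 'a, 'e) tensor2"
    and V :: "'a \<Rightarrow> real"
    and h :: real
  defines "M\<^sub>h \<equiv> sublevel_manifold M V h"
    and "m\<^sub>h \<equiv> jacobi_metric m V h"
  assumes "mechanical_system M m V \<kappa>"
    and "points M\<^sub>h \<noteq> {}"
  shows
    "(\<forall>I x J y. motion M m V \<kappa> I x \<longrightarrow> (\<forall>t\<in>I. x t \<in> points M\<^sub>h) \<longrightarrow>
        (\<forall>t\<in>I. total_energy M m V x t = h) \<longrightarrow>
        arclength_reparametrization M\<^sub>h m\<^sub>h I x J y \<longrightarrow>
        gyroscopic_geodesic M\<^sub>h m\<^sub>h \<kappa> J y) \<and>
     (\<forall>J y. (\<forall>\<tau>\<in>J. y \<tau> \<in> points M\<^sub>h) \<longrightarrow>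
        parametrized_by_arclength M\<^sub>h m\<^sub>h J y \<longrightarrow>
        gyroscopic_geodesic M\<^sub>h m\<^sub>h \<kappa> J y \<longrightarrow>
        (\<exists>I s. open_interval I \<and> parameter_change I J s \<and>
           motion M m V \<kappa> I (y \<circ> s) \<and>
           (\<forall>t\<in>I. total_energy M m V (y \<circ> s) t = h)))"
proof -
  interpret jacobi M m V \<kappa> h by unfold_locales (rule assms(3))
  show ?thesis
    unfolding M\<^sub>h_def m\<^sub>h_def
    using motion_imp_gyroscopic_geodesic gyroscopic_geodesic_imp_motion by blast
qed

end
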